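(* Let $d\ge 1$ be an integer, $\vec{\mu}=(\mu_0,\dots,\mu_{d-1})$ a probability distribution, and $\mathcal{O}_{\vec{\mu}}$ the generalized platypus channel associated with $\vec{\mu}$. Then $$P^{(1)}(\mathcal{O}_{\vec{\mu}})=C^{(1)}(\mathcal{O}_{\vec{\mu}})=P(\mathcal{O}_{\vec{\mu}})=C(\mathcal{O}_{\vec{\mu}})=1,\qquad C_E(\mathcal{O}_{\vec{\mu}})=2.$$
   Context: Logarithms are base 2. Generalized platypus channel: let $A$ and $B$ be $(d+1)$-dimensional Hilbert spaces with computational bases $\{|i\rangle\}_{i=0}^{d}$ and $E$ a $d$-dimensional Hilbert space with basis $\{|j\rangle\}_{j=0}^{d-1}$. Define the isometry $V:A\to B\otimes E$ by $V|0\rangle=\sum_{j=0}^{d-1}\sqrt{\mu_j}\,|j\rangle_B\otimes|j\rangle_E$ and $V|i\rangle=|d\rangle_B\otimes|i-1\rangle_E$ for $i=1,\dots,d$; $\mathcal{O}_{\vec{\mu}}(\rho)=\mathrm{Tr}_E(V\rho V^\dagger)$ and $\mathcal{O}^c_{\vec{\mu}}(\rho)=\mathrm{Tr}_B(V\rho V^\dagger)$. For a channel $\mathcal{N}$ with complementary channel $\mathcal{N}^c$ and $S$ the von Neumann entropy: $I_c(\rho,\mathcal{N})=S(\mathcal{N}(\rho))-S(\mathcal{N}^c(\rho))$; for an ensemble $\{p_i,\rho_i\}$, $I_p(\{p_i,\rho_i\},\mathcal{N})=I_c(\sum_ip_i\rho_i,\mathcal{N})-\sum_ip_iI_c(\rho_i,\mathcal{N})$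 and $\chi(\{p_i,\rho_i\},\mathcal{N})=S(\mathcal{N}(\sum_ip_i\rho_i))-\sum_ip_iS(\mathcal{N}(\rho_i))$. The private information is $P^{(1)}(\mathcal{N})=\max I_p$ and the Holevo capacity is $C^{(1)}(\mathcal{N})=\max\chi$, maxima over ensembles; the private capacity is $P(\mathcal{N})=\lim_n\frac1nP^{(1)}(\mathcal{N}^{\otimes n})$ and the classical capacity is $C(\mathcal{N})=\lim_n\frac1nC^{(1)}(\mathcal{N}^{\otimes n})$. The entanglement-assisted classical capacity is $C_E(\mathcal{N})=\max_\rho[S(\rho)+I_c(\rho,\mathcal{N})]$. *)

theory Defs
  imports "Jordan_Normal_Form.Schur_Decomposition" "Jordan_Normal_Form.Char_Poly"
begin

definition mtrace :: "complex mat \<Rightarrow> complex" where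
  "mtrace A = (\<Sum>i<dim_row A. A $$ (i, i))"

definition density :: "nat \<Rightarrow> complex mat \<Rightarrow> bool" where
  "density n \<rho> \<longleftrightarrow> \<rho> \<in> carrier_mat n n \<and> mat_adjoint \<rho> = \<rho>
     \<and> (\<forall>v \<in> carrier_vec n. 0 \<le> Re (\<Sum>i<n. cnj (v $ i) * (\<rho> *\<^sub>v v) $ i))
     \<and> mtrace \<rho> = 1"

definition entropy_fun :: "real \<Rightarrow> real" where
  "entropy_fun x = - x * log 2 x"

definition vN_entropy :: "complex mat \<Rightarrow> real" where
  "vN_entropy \<rho> = (\<Sum>a \<in> {a. poly (char_poly \<rho>) a = 0}.
        real (order a (char_poly \<rho>)) * entropy_fun (Re a))"

text \<open>A channel is given by (dB, dE, V) with V an isometry from C^dA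
  (dA = dim_col V) into C^dB \<otimes> C^dE, the basis vector |b>|e> having index
  b * dE + e.\<close>
type_synonym stinespring = "nat \<times> nat \<times> complex mat"

definition in_dim :: "stinespring \<Rightarrow> nat" where
  "in_dim N = dim_col (snd (snd N))"

definition ptrace_E :: "nat \<Rightarrow> nat \<Rightarrow> complex mat \<Rightarrow> complex mat" where
  "ptrace_E dB dE M = mat dB dB (\<lambda>(b, b'). \<Sum>e<dE. M $$ (b * dE + e, b' * dE + e))"

definition ptrace_B :: "nat \<Rightarrow> nat \<Rightarrow> complex mat \<Rightarrow> complex mat" where
  "ptrace_B dB dE M = mat dE dE (\<lambda>(e, e'). \<Sum>b<dB. M $$ (b * dE + e, b * dE + e'))"

definition channel :: "stinespring \<Rightarrow> complex mat \<Rightarrow> complex mat" where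
  "channel N \<rho> = (case N of (dB, dE, V) \<Rightarrow> ptrace_E dB dE (V * \<rho> * mat_adjoint V))"

definition compl_channel :: "stinespring \<Rightarrow> complex mat \<Rightarrow> complex mat" where
  "compl_channel N \<rho> = (case N of (dB, dE, V) \<Rightarrow> ptrace_B dB dE (V * \<rho> * mat_adjoint V))"

text \<open>Tensor product of two Stinespring dilations: V1 \<otimes> V2 regarded as an
  isometry A1A2 \<rightarrow> (B1B2) \<otimes> (E1E2).\<close>
definition iso_tensor :: "stinespring \<Rightarrow> stinespring \<Rightarrow> stinespring" where
  "iso_tensor N1 N2 = (case N1 of (dB1, dE1, V1) \<Rightarrow> case N2 of (dB2, dE2, V2) \<Rightarrow>
     (dB1 * dB2, dE1 * dE2,
      mat (dB1 * dB2 * (dE1 * dE2)) (dim_col V1 * dim_col V2)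
        (\<lambda>(r, c). let bb = r div (dE1 * dE2); ee = r mod (dE1 * dE2);
                      b1 = bb div dB2; b2 = bb mod dB2;
                      e1 = ee div dE2; e2 = ee mod dE2;
                      a1 = c div dim_col V2; a2 = c mod dim_col V2
                  in V1 $$ (b1 * dE1 + e1, a1) * V2 $$ (b2 * dE2 + e2, a2))))"

primrec tensor_pow :: "stinespring \<Rightarrow> nat \<Rightarrow> stinespring" where
  "tensor_pow N 0 = (1, 1, 1\<^sub>m 1)"
| "tensor_pow N (Suc n) = iso_tensor (tensor_pow N n) N"

definition coherent_info :: "complex mat \<Rightarrow> stinespring \<Rightarrow> real" where
  "coherent_info \<rho> N = vN_entropy (channel N \<rho>) - vN_entropy (compl_channel N \<rho>)"

definition ensemble :: "nat \<Rightarrow> nat \<Rightarrow> (nat \<Rightarrow> real) \<Rightarrow> (nat \<Rightarrow> complex mat) \<Rightarrow> bool" where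
  "ensemble n m p \<rho> \<longleftrightarrow> (\<forall>i<m. 0 \<le> p i \<and> density n (\<rho> i)) \<and> (\<Sum>i<m. p i) = 1"

definition ens_avg :: "nat \<Rightarrow> nat \<Rightarrow> (nat \<Rightarrow> real) \<Rightarrow> (nat \<Rightarrow> complex mat) \<Rightarrow> complex mat" where
  "ens_avg n m p \<rho> = mat n n (\<lambda>ij. \<Sum>i<m. complex_of_real (p i) * \<rho> i $$ ij)"

definition private_info_ens ::
  "stinespring \<Rightarrow> nat \<Rightarrow> (nat \<Rightarrow> real) \<Rightarrow> (nat \<Rightarrow> complex mat) \<Rightarrow> real" where
  "private_info_ens N m p \<rho> = coherent_info (ens_avg (in_dim N) m p \<rho>) N
      - (\<Sum>i<m. p i * coherent_info (\<rho> i) N)"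

definition holevo_ens ::
  "stinespring \<Rightarrow> nat \<Rightarrow> (nat \<Rightarrow> real) \<Rightarrow> (nat \<Rightarrow> complex mat) \<Rightarrow> real" where
  "holevo_ens N m p \<rho> = vN_entropy (channel N (ens_avg (in_dim N) m p \<rho>))
      - (\<Sum>i<m. p i * vN_entropy (channel N (\<rho> i)))"

definition private_information :: "stinespring \<Rightarrow> real" where
  "private_information N =
     Sup {private_info_ens N m p \<rho> | m p \<rho>. ensemble (in_dim N) m p \<rho>}"

definition holevo_capacity :: "stinespring \<Rightarrow> real" where
  "holevo_capacity N =
     Sup {holevo_ens N m p \<rho> | m p \<rho>. ensemble (in_dim N) m p \<rho>}"

definition ea_capacity :: "stinespring \<Rightarrow> real" where
  "ea_capacity N = Sup {vN_entropy \<rho> + coherent_info \<rho> N | \<rho>. density (in_dim N) \<rho>}"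

text \<open>A = C^(d+1), B = C^(d+1), E = C^d;
  V|0> = \<Sum>_{j<d} sqrt(\<mu>_j) |j>_B |j>_E,  V|i> = |d>_B |i-1>_E  (1 \<le> i \<le> d).\<close>
definition platypus_iso :: "nat \<Rightarrow> (nat \<Rightarrow> real) \<Rightarrow> complex mat" where
  "platypus_iso d \<mu> = mat ((d + 1) * d) (d + 1) (\<lambda>(r, c).
     (let b = r div d; e = r mod d in
      if c = 0 then (if b = e \<and> b < d then complex_of_real (sqrt (\<mu> b)) else 0)
      else (if b = d \<and> e = c - 1 then 1 else 0)))"

definition platypus :: "nat \<Rightarrow> (nat \<Rightarrow> real) \<Rightarrow> stinespring" where
  "platypus d \<mu> = (d + 1, d, platypus_iso d \<mu>)"

end

theory Submission
  imports Defs "HOL-Analysis.L2_Norm"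
begin

text \<open>
  Let \<open>\<sigma>\<close> be the diagonal state with entries \<open>\<mu>\<^sub>j/2\<close> and \<open>1/2\<close>. Every output of the \<open>n\<close>-th tensor power of
  the channel is at most \<open>2\<^sup>n \<sigma>\<^sup>\<otimes>\<^sup>n\<close>, also for entangled inputs: after rescaling the output by
  \<open>\<sigma>\<^sup>-\<^sup>1\<^sup>/\<^sup>2\<close>, the input factors \<open>|0\<rangle>\<close> and \<open>|1\<rangle>, \<dots>, |d\<rangle>\<close> lead to orthogonal contributions, and a
  Cauchy-Schwarz argument inducts over \<open>n\<close>. Hence the relative entropy of any output to \<open>\<sigma>\<^sup>\<otimes>\<^sup>n\<close> is
  at most \<open>n\<close>, which bounds the Holevo information by \<open>n\<close>; by concavity of the entropy on the
  environment the private information is bounded by the Holevo information. Both bounds are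
  attained by product code words over the letters \<open>|0\<rangle>\<langle>0|\<close> and \<open>\<Sum>\<^sub>j \<mu>\<^sub>j |j+1\<rangle>\<langle>j+1|\<close>, which the
  environment cannot distinguish. For the entanglement-assisted capacity the same \<open>\<sigma>\<close> gives the upper
  bound \<open>log 4\<close>, attained at the equal mixture of the two letters.
\<close>

subsection \<open>Sums and inequalities\<close>

text \<open>The state \<sigma> is the mean output of the two code letters. Before normalisation it
  has total mass 2, namely 1 from \<mu> and 1 from the last level, whence one bit per use. The
  Holevo quantity equals the mean relative entropy of the outputs to \<sigma> minus that of the mean
  output, so a uniform bound on the former is enough.

  The obstacle is additivity. The largest overlap of an isometry with product vectors
  \<open>x \<otimes> y\<close> is not multiplicative for general channels, so the induction is
  asymmetric: the accumulated factor enters only through its bound, while the added factor is an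
  explicit platypus channel.

  No matrix logarithm occurs. Since \<sigma> is diagonal, cross entropies involve only diagonal
  entries, and the entropy estimates rest on the scalar Jensen inequality
  \<open>sum_weighted_log_le\<close> with weights built from squared overlaps. The code has diagonal
  inputs and outputs, so its entropies are Shannon entropies of product distributions.\<close>

lemma cmod_sum_mult_le:
  fixes a b :: "'i \<Rightarrow> complex"
  shows "(cmod (\<Sum>i\<in>A. a i * b i))\<^sup>2 \<le> (\<Sum>i\<in>A. (cmod (a i))\<^sup>2) * (\<Sum>i\<in>A. (cmod (b i))\<^sup>2)"
proof -
  have "cmod (\<Sum>i\<in>A. a i * b i) \<le> (\<Sum>i\<in>A. \<bar>cmod (a i)\<bar> * \<bar>cmod (b i)\<bar>)"
    using norm_sum[of "\<lambda>i. a i * b i" A] by (simp add: norm_mult)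
  also have "\<dots> \<le> L2_set (\<lambda>i. cmod (a i)) A * L2_set (\<lambda>i. cmod (b i)) A"
    by (rule L2_set_mult_ineq)
  finally have "(cmod (\<Sum>i\<in>A. a i * b i))\<^sup>2 \<le> (L2_set (\<lambda>i. cmod (a i)) A * L2_set (\<lambda>i. cmod (b i)) A)\<^sup>2"
    by (intro power_mono) auto
  then show ?thesis
    by (simp add: L2_set_def power_mult_distrib sum_nonneg)
qed

text \<open>The index of a tensor product is \<open>i * n + j\<close>; sums over composite systems
  are split into sums over the factors this way.\<close>

lemma sum_lessThan_times:
  fixes f :: "nat \<Rightarrow> 'a::comm_monoid_add"
  shows "(\<Sum>i<m*n. f i) = (\<Sum>i<m. \<Sum>j<n. f (i * n + j))"
proof -
  have "(\<Sum>i<m*n. f i) = (\<Sum>i<m. sum f {i*n..<i*n+n})"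
    by (simp add: sum.nat_group)
  also have "\<dots> = (\<Sum>i<m. \<Sum>j<n. f (i * n + j))"
  proof (rule sum.cong)
    fix i
    show "sum f {i*n..<i*n+n} = (\<Sum>j<n. f (i * n + j))"
      using sum.shift_bounds_nat_ivl[of f 0 "i*n" n] by (simp add: lessThan_atLeast0 add.commute)
  qed simp
  finally show ?thesis .
qed

text \<open>Jensen's inequality for the logarithm, obtained from its tangent at \<open>C\<close>.
  Positivity of \<open>r\<close> is demanded only where the weight is positive, because in the
  applications \<open>r\<close> is a quotient of eigenvalues or weights that may vanish off the
  support.\<close>

lemma sum_weighted_log_le:
  fixes w r :: "'i \<Rightarrow> real"
  assumes "finite X" and w: "\<And>x. x \<in> X \<Longrightarrow> 0 \<le> w x" and w1: "(\<Sum>x\<in>X. w x) = 1"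
    and r: "\<And>x. x \<in> X \<Longrightarrow> 0 < w x \<Longrightarrow> 0 < r x"
    and c: "(\<Sum>x\<in>X. w x * r x) \<le> C" and C: "0 < C"
  shows "(\<Sum>x\<in>X. w x * log 2 (r x)) \<le> log 2 C"
proof -
  have "w x * log 2 (r x) \<le> (w x * r x / C - w x) / ln 2 + w x * log 2 C" if x: "x \<in> X" for x
  proof (cases "w x = 0")
    case False
    then have wx: "0 < w x" using w[OF x] by simp
    have rx: "0 < r x" using r[OF x wx] .
    have "ln (r x / C) \<le> r x / C - 1"
      using rx C by (intro ln_le_minus_one) simp
    then have "ln (r x) - ln C \<le> r x / C - 1"
      using rx C by (simp add: ln_div)
    then have "w x * (ln (r x) - ln C) \<le> w x * (r x / C - 1)"
      using wx by simp
    then have "(w x * (ln (r x) - ln C)) / ln 2 \<le> (w x * (r x / C - 1)) / ln 2"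
      by (intro divide_right_mono) auto
    then show ?thesis
      by (simp add: log_def algebra_simps add_divide_distrib diff_divide_distrib)
  qed simp
  then have "(\<Sum>x\<in>X. w x * log 2 (r x)) \<le> (\<Sum>x\<in>X. (w x * r x / C - w x) / ln 2 + w x * log 2 C)"
    by (rule sum_mono)
  also have "\<dots> = ((\<Sum>x\<in>X. w x * r x) / C - 1) / ln 2 + log 2 C"
    by (simp add: sum.distrib sum_subtractf w1 flip: sum_divide_distrib sum_distrib_right)
  also have "\<dots> \<le> log 2 C"
    using c C by (simp add: divide_le_0_iff)
  finally show ?thesis .
qed

subsection \<open>Spectral theorem for Hermitian matrices\<close>

lemma mat_adjoint_dim [simp]:
  "dim_row (mat_adjoint A) = dim_col A" "dim_col (mat_adjoint A) = dim_row A"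
  by (auto simp: mat_adjoint_def)

lemma mat_adjoint_carrier [simp]:
  "mat_adjoint A \<in> carrier_mat m n \<longleftrightarrow> A \<in> carrier_mat n m"
  unfolding carrier_mat_def mem_Collect_eq mat_adjoint_dim by (rule conj_commute)

lemma mat_adjoint_index [simp]:
  fixes A :: "complex mat"
  shows "i < dim_col A \<Longrightarrow> j < dim_row A \<Longrightarrow> mat_adjoint A $$ (i, j) = cnj (A $$ (j, i))"
  by (simp add: mat_adjoint_def mat_of_rows_index)

lemma mat_adjoint_mult:
  fixes A B :: "complex mat"
  assumes "A \<in> carrier_mat l m" "B \<in> carrier_mat m n"
  shows "mat_adjoint (A * B) = mat_adjoint B * mat_adjoint A"
  using assms by (intro eq_matI) (auto simp: scalar_prod_def mult.commute)

lemma mat_adjoint_adjoint [simp]: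
  fixes A :: "complex mat"
  shows "mat_adjoint (mat_adjoint A) = A"
  by (intro eq_matI) auto

lemma mat_adjoint_four_block:
  fixes A B C D :: "complex mat"
  assumes "A \<in> carrier_mat n1 m1" "B \<in> carrier_mat n1 m2" "C \<in> carrier_mat n2 m1" "D \<in> carrier_mat n2 m2"
  shows "mat_adjoint (four_block_mat A B C D)
    = four_block_mat (mat_adjoint A) (mat_adjoint C) (mat_adjoint B) (mat_adjoint D)"
  using assms by (intro eq_matI) auto

lemma mat_adjoint_zero [simp]: "mat_adjoint (0\<^sub>m m n :: complex mat) = 0\<^sub>m n m"
  by (intro eq_matI) auto

lemma mat_adjoint_one [simp]: "mat_adjoint (1\<^sub>m n :: complex mat) = 1\<^sub>m n"
  by (intro eq_matI) auto

text \<open>Complete \<open>v\<close> to a basis, apply Gram-Schmidt, which keeps the first vector,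
  and normalise; \<open>c\<close> is the normalising factor of \<open>v\<close>.\<close>

lemma unitary_with_first_column:
  fixes v :: "complex vec"
  assumes v: "v \<in> carrier_vec n" "v \<noteq> 0\<^sub>v n"
  shows "\<exists>U c. U \<in> carrier_mat n n \<and> mat_adjoint U * U = 1\<^sub>m n \<and> col U 0 = c \<cdot>\<^sub>v v"
proof -
  interpret cof_vec_space n "TYPE(complex)" .
  define b where "b = basis_completion v"
  from basis_completion[OF v, folded b_def]
  have dist: "distinct b" and indep: "\<not> lin_dep (set b)" and b: "set b \<subseteq> carrier_vec n"
    and hdb: "hd b = v" and len: "length b = n" by auto
  define ws where "ws = gram_schmidt n b"
  from gram_schmidt_result[OF b dist indep refl, folded ws_def]
  have ws: "set ws \<subseteq> carrier_vec n" "corthogonal ws" "length ws = n" by (auto simp: len)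
  have n0: "0 < n" using v by (cases n) auto
  obtain vs where "b = v # vs" using hdb len n0 by (cases b) auto
  then have "hd ws = v" unfolding ws_def using gram_schmidt_hd[OF v(1), of vs] by simp
  then have ws0: "ws ! 0 = v" using ws(3) n0 by (cases ws) auto
  have wsc: "ws ! i \<in> carrier_vec n" if "i < n" for i
    using that ws by auto
  define s where "s i = sqrt (\<Sum>j<n. (cmod (ws ! i $ j))\<^sup>2)" for i
  have sq: "ws ! i \<bullet>c ws ! i = complex_of_real ((s i)\<^sup>2)" if "i < n" for i
    using wsc[OF that] that
    by (auto simp: scalar_prod_def s_def sum_nonneg lessThan_atLeast0 simp del: of_real_power
        simp flip: complex_norm_square of_real_mult intro!: sum.cong)
  have s0: "s i \<noteq> 0" if "i < n" for i
    using corthogonalD[OF ws(2), of i i] sq[OF that] that ws(3) by auto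
  define U where "U = mat n n (\<lambda>(j, i). complex_of_real (1 / s i) * ws ! i $ j)"
  have U: "U \<in> carrier_mat n n" by (simp add: U_def)
  have "mat_adjoint U * U = 1\<^sub>m n"
  proof (intro eq_matI)
    fix i k assume "i < dim_row (1\<^sub>m n)" "k < dim_col (1\<^sub>m n)"
    then have ik: "i < n" "k < n" by auto
    have "(mat_adjoint U * U) $$ (i, k)
      = (\<Sum>j<n. complex_of_real (1 / s i) * complex_of_real (1 / s k) * (ws ! k $ j * cnj (ws ! i $ j)))"
      using ik U by (auto simp: scalar_prod_def U_def lessThan_atLeast0 intro!: sum.cong)
    also have "\<dots> = complex_of_real (1 / s i) * complex_of_real (1 / s k) * (ws ! k \<bullet>c ws ! i)"
      using wsc[OF ik(1)] ik by (simp add: scalar_prod_def lessThan_atLeast0 sum_distrib_left)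
    also have "\<dots> = (if i = k then 1 else 0)"
      using corthogonalD[OF ws(2), of k i] ik ws(3) sq[OF ik(1)] s0[OF ik(1)]
      by (auto simp: power2_eq_square)
    finally show "(mat_adjoint U * U) $$ (i, k) = 1\<^sub>m n $$ (i, k)" using ik by simp
  qed (use U in auto)
  moreover have "col U 0 = complex_of_real (1 / s 0) \<cdot>\<^sub>v v"
    using n0 v ws0 by (intro eq_vecI) (auto simp: U_def)
  ultimately show ?thesis using U by blast
qed

text \<open>Deflation: conjugating by a unitary whose first column is an eigenvector clears the
  first column below the diagonal, Hermiticity then clears the first row, and the induction
  hypothesis diagonalises the remaining Hermitian block.\<close>

lemma hermitian_unitary_diagonalization:
  fixes A :: "complex mat"
  assumes "A \<in> carrier_mat n n" "mat_adjoint A = A"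
  shows "\<exists>U. U \<in> carrier_mat n n \<and> mat_adjoint U * U = 1\<^sub>m n \<and> diagonal_mat (mat_adjoint U * A * U)"
  using assms
proof (induction n arbitrary: A)
  case 0
  then show ?case by (intro exI[of _ "1\<^sub>m 0"]) (auto simp: diagonal_mat_def)
next
  case (Suc n)
  note A = Suc.prems(1)
  let ?N = "Suc n"
  have "\<exists>e. poly (char_poly A) e = 0"
    using degree_monic_char_poly[OF A] fundamental_theorem_of_algebra[of "char_poly A"]
    by (simp add: constant_degree)
  then obtain e v where "eigenvector A v e"
    using eigenvalue_root_char_poly[OF A] unfolding eigenvalue_def by blast
  then have v: "v \<in> carrier_vec ?N" "v \<noteq> 0\<^sub>v ?N" and Av: "A *\<^sub>v v = e \<cdot>\<^sub>v v"
    using A by (auto simp: eigenvector_def)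
  obtain U c where U: "U \<in> carrier_mat ?N ?N" and UU: "mat_adjoint U * U = 1\<^sub>m ?N"
    and U0: "col U 0 = c \<cdot>\<^sub>v v"
    using unitary_with_first_column[OF v] by blast
  have Ua: "mat_adjoint U \<in> carrier_mat ?N ?N" using U by simp
  define A' where "A' = mat_adjoint U * A * U"
  have A': "A' \<in> carrier_mat ?N ?N" using A U Ua by (auto simp: A'_def)
  have herm: "mat_adjoint A' = A'"
    unfolding A'_def using A U Ua Suc.prems(2)
    by (simp add: mat_adjoint_mult[of _ ?N ?N _ ?N] assoc_mult_mat[of _ ?N ?N _ ?N _ ?N])
  have col0: "A' $$ (i, 0) = (if i = 0 then e else 0)" if "i < ?N" for i
  proof -
    have "A' $$ (i, 0) = ((mat_adjoint U * (A * U))) $$ (i, 0)"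
      using A U Ua by (simp add: A'_def assoc_mult_mat[of _ ?N ?N _ ?N _ ?N])
    also have "\<dots> = row (mat_adjoint U) i \<bullet> (A *\<^sub>v col U 0)"
      using that A U by (subst index_mult_mat) (auto simp: mult_mat_vec_def intro!: arg_cong2[of _ _ _ _ "(\<bullet>)"])
    also have "\<dots> = row (mat_adjoint U) i \<bullet> (e \<cdot>\<^sub>v col U 0)"
      unfolding U0 mult_mat_vec[OF A v(1)] Av smult_smult_assoc by (simp only: mult.commute)
    also have "\<dots> = e * (row (mat_adjoint U) i \<bullet> col U 0)"
    proof (rule scalar_prod_smult_distrib[of _ ?N])
      show "row (mat_adjoint U) i \<in> carrier_vec ?N" by (rule row_carrier_vec[OF that Ua])
      show "col U 0 \<in> carrier_vec ?N" by (rule col_carrier_vec[OF _ U]) simp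
    qed
    also have "\<dots> = e * (mat_adjoint U * U) $$ (i, 0)"
      using that carrier_matD[OF U] by (subst index_mult_mat) auto
    finally show ?thesis using that by (simp add: UU)
  qed
  have row0: "A' $$ (0, i) = 0" if "i < ?N" "i \<noteq> 0" for i
    using mat_adjoint_index[of 0 A' i] herm col0[OF that(1)] that A' by auto
  define E where "E = mat 1 1 (\<lambda>_. e)"
  define A3 where "A3 = mat n n (\<lambda>(i, j). A' $$ (Suc i, Suc j))"
  have E: "E \<in> carrier_mat 1 1" and A3: "A3 \<in> carrier_mat n n" by (auto simp: E_def A3_def)
  have blk: "A' = four_block_mat E (0\<^sub>m 1 n) (0\<^sub>m n 1) A3"
    using A' col0 row0 by (intro eq_matI) (auto simp: E_def A3_def)
  have "mat_adjoint A3 = A3"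
  proof (intro eq_matI)
    fix i j assume "i < dim_row A3" "j < dim_col A3"
    then show "mat_adjoint A3 $$ (i, j) = A3 $$ (i, j)"
      using mat_adjoint_index[of "Suc i" A' "Suc j"] A' by (auto simp: herm A3_def)
  qed (auto simp: A3_def)
  from Suc.IH[OF A3 this] obtain W where W: "W \<in> carrier_mat n n"
    and WW: "mat_adjoint W * W = 1\<^sub>m n" and D: "diagonal_mat (mat_adjoint W * A3 * W)" by blast
  define X where "X = four_block_mat (1\<^sub>m 1) (0\<^sub>m 1 n) (0\<^sub>m n 1) W"
  have X: "X \<in> carrier_mat ?N ?N" using W by (auto simp: X_def)
  have Xa: "mat_adjoint X = four_block_mat (1\<^sub>m 1) (0\<^sub>m 1 n) (0\<^sub>m n 1) (mat_adjoint W)"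
    unfolding X_def using W by (subst mat_adjoint_four_block[of _ 1 1 _ n _ n]) auto
  have Wa: "mat_adjoint W \<in> carrier_mat n n" using W by simp
  have XX: "mat_adjoint X * X = 1\<^sub>m ?N"
    unfolding Xa unfolding X_def
    by (subst mult_four_block_mat[of _ 1 1 _ n _ n _ _ 1 _ n]) (use W Wa WW in \<open>auto intro!: eq_matI\<close>)
  have "mat_adjoint X * A' = four_block_mat E (0\<^sub>m 1 n) (0\<^sub>m n 1) (mat_adjoint W * A3)"
    unfolding Xa blk
    by (subst mult_four_block_mat[of _ 1 1 _ n _ n _ _ 1 _ n]) (use W Wa E A3 in auto)
  then have XAX: "mat_adjoint X * A' * X = four_block_mat E (0\<^sub>m 1 n) (0\<^sub>m n 1) (mat_adjoint W * A3 * W)"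
    unfolding X_def
    by (simp, subst mult_four_block_mat[of _ 1 1 _ n _ n _ _ 1 _ n]) (use W Wa E A3 in auto)
  have Xac: "mat_adjoint X \<in> carrier_mat ?N ?N" using X by simp
  have adj: "mat_adjoint (U * X) = mat_adjoint X * mat_adjoint U"
    using U X by (rule mat_adjoint_mult)
  have "mat_adjoint (U * X) * (U * X) = mat_adjoint X * (mat_adjoint U * U) * X"
    unfolding adj using U Ua X Xac by (simp add: assoc_mult_mat[of _ ?N ?N _ ?N _ ?N])
  also have "\<dots> = 1\<^sub>m ?N" using XX Xac by (simp add: UU)
  finally have 1: "mat_adjoint (U * X) * (U * X) = 1\<^sub>m ?N" .
  have "mat_adjoint (U * X) * A * (U * X) = mat_adjoint X * A' * X"
    unfolding adj A'_def using U Ua X Xac A by (simp add: assoc_mult_mat[of _ ?N ?N _ ?N _ ?N])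
  moreover have "diagonal_mat (mat_adjoint X * A' * X)"
    unfolding XAX diagonal_mat_def
  proof (intro allI impI)
    fix i j assume ij: "i < dim_row (four_block_mat E (0\<^sub>m 1 n) (0\<^sub>m n 1) (mat_adjoint W * A3 * W))"
      "j < dim_col (four_block_mat E (0\<^sub>m 1 n) (0\<^sub>m n 1) (mat_adjoint W * A3 * W))" "i \<noteq> j"
    then have "i < Suc n" "j < Suc n" using E W by auto
    then show "four_block_mat E (0\<^sub>m 1 n) (0\<^sub>m n 1) (mat_adjoint W * A3 * W) $$ (i, j) = 0"
      using ij D E W unfolding diagonal_mat_def by (cases i; cases j) auto
  qed
  ultimately show ?case using 1 U X by (intro exI[of _ "U * X"]) auto
qed

text \<open>Bridges the definition of \<open>vN_entropy\<close>, which runs over distinct roots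
  weighted by \<open>order\<close>, and a sum over eigenvalues listed with repetition: the order of
  \<open>a\<close> is the number of indices \<open>k\<close> with \<open>c k = a\<close>.\<close>

lemma sum_order_prod_linear:
  fixes c :: "nat \<Rightarrow> complex" and f :: "complex \<Rightarrow> real"
  assumes "finite K"
  shows "(\<Sum>a \<in> {a. poly (\<Prod>k\<in>K. [:- c k, 1:]) a = 0}. real (order a (\<Prod>k\<in>K. [:- c k, 1:])) * f a)
    = (\<Sum>k\<in>K. f (c k))"
proof -
  have ord: "order a (\<Prod>k\<in>K. [:- c k, 1:]) = card {k \<in> K. c k = a}" for a
    using assms
  proof (induction K)
    case (insert k K)
    have "order a ([:- c k, 1:] * (\<Prod>k\<in>K. [:- c k, 1:]))
      = order a [:- c k, 1:] + order a (\<Prod>k\<in>K. [:- c k, 1:])"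
      using insert by (intro order_mult) (auto simp del: mult_pCons_left)
    moreover have "order a [:- c k, 1:] = (if c k = a then 1 else 0)"
      using order_power_n_n[of a 1] by (auto intro: order_0I)
    moreover have "{j \<in> insert k K. c j = a} = (if c k = a then insert k {j \<in> K. c j = a} else {j \<in> K. c j = a})"
      by auto
    ultimately show ?case using insert by auto
  qed simp
  have roots: "{a. poly (\<Prod>k\<in>K. [:- c k, 1:]) a = 0} = c ` K"
    using assms by (auto simp: poly_prod)
  have "(\<Sum>a \<in> c ` K. real (card {k \<in> K. c k = a}) * f a) = (\<Sum>a \<in> c ` K. \<Sum>k | k \<in> K \<and> c k = a. f (c k))"
    by simp
  also have "\<dots> = (\<Sum>k\<in>K. f (c k))"
    using assms by (intro sum.group) auto
  finally show ?thesis by (simp add: ord roots)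
qed

lemma vN_entropy_upper_triangular:
  assumes A: "A \<in> carrier_mat n n" and D: "D \<in> carrier_mat n n" "upper_triangular D" and sim: "similar_mat A D"
  shows "vN_entropy A = (\<Sum>k<n. entropy_fun (Re (D $$ (k, k))))"
proof -
  have "char_poly A = (\<Prod>a\<leftarrow>diag_mat D. [:- a, 1:])"
    using char_poly_similar[OF sim] char_poly_upper_triangular[OF D] by simp
  also have "\<dots> = (\<Prod>k<n. [:- (D $$ (k, k)), 1:])"
    using D by (simp add: diag_mat_def prod.list_conv_set_nth lessThan_atLeast0)
  finally show ?thesis
    unfolding vN_entropy_def using sum_order_prod_linear[of "{..<n}" "\<lambda>k. D $$ (k, k)" "\<lambda>a. entropy_fun (Re a)"]
    by simp
qed

subsection \<open>Density matrices and entropy inequalities\<close>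

text \<open>Vectors are plain functions here, so that test vectors can be written down without
  carrier conditions.\<close>

definition qform :: "nat \<Rightarrow> complex mat \<Rightarrow> (nat \<Rightarrow> complex) \<Rightarrow> complex" where
  "qform n \<rho> v = (\<Sum>i<n. \<Sum>j<n. cnj (v i) * \<rho> $$ (i, j) * v j)"

text \<open>The second half is the completeness relation, which is the form that Parseval's identity
  \<open>onb_parseval\<close> uses.\<close>

definition onb :: "nat \<Rightarrow> (nat \<Rightarrow> nat \<Rightarrow> complex) \<Rightarrow> bool" where
  "onb n u \<longleftrightarrow> (\<forall>k<n. \<forall>l<n. (\<Sum>i<n. cnj (u k i) * u l i) = (if k = l then 1 else 0))
     \<and> (\<forall>i<n. \<forall>j<n. (\<Sum>k<n. u k i * cnj (u k j)) = (if i = j then 1 else 0))"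

lemma density_iff_qform:
  "density n \<rho> \<longleftrightarrow> \<rho> \<in> carrier_mat n n \<and> (\<forall>i<n. \<forall>j<n. \<rho> $$ (i, j) = cnj (\<rho> $$ (j, i)))
     \<and> (\<forall>v. 0 \<le> Re (qform n \<rho> v)) \<and> (\<Sum>i<n. \<rho> $$ (i, i)) = 1"
proof (cases "\<rho> \<in> carrier_mat n n")
  case True
  then have d: "dim_row \<rho> = n" "dim_col \<rho> = n" by auto
  have q: "(\<Sum>i<n. cnj (v $ i) * (\<rho> *\<^sub>v v) $ i) = qform n \<rho> (\<lambda>i. v $ i)" if "v \<in> carrier_vec n" for v
    using that d by (auto simp: qform_def scalar_prod_def lessThan_atLeast0 sum_distrib_left mult.assoc intro!: sum.cong)
  have "(\<forall>v \<in> carrier_vec n. 0 \<le> Re (\<Sum>i<n. cnj (v $ i) * (\<rho> *\<^sub>v v) $ i))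
      \<longleftrightarrow> (\<forall>v \<in> carrier_vec n. 0 \<le> Re (qform n \<rho> (\<lambda>i. v $ i)))"
    using q by metis
  moreover have "(\<forall>v \<in> carrier_vec n. 0 \<le> Re (qform n \<rho> (\<lambda>i. v $ i))) \<longleftrightarrow> (\<forall>v. 0 \<le> Re (qform n \<rho> v))"
  proof (intro iffI allI ballI)
    fix v assume *: "\<forall>v \<in> carrier_vec n. 0 \<le> Re (qform n \<rho> (\<lambda>i. v $ i))"
    have "qform n \<rho> (\<lambda>i. vec n v $ i) = qform n \<rho> v" by (simp add: qform_def)
    then show "0 \<le> Re (qform n \<rho> v)" using *[rule_format, of "vec n v"] by simp
  qed auto
  moreover have "mat_adjoint \<rho> = \<rho> \<longleftrightarrow> (\<forall>i<n. \<forall>j<n. \<rho> $$ (i, j) = cnj (\<rho> $$ (j, i)))"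
  proof
    assume h: "mat_adjoint \<rho> = \<rho>"
    show "\<forall>i<n. \<forall>j<n. \<rho> $$ (i, j) = cnj (\<rho> $$ (j, i))"
    proof (intro allI impI)
      fix i j assume "i < n" "j < n"
      then show "\<rho> $$ (i, j) = cnj (\<rho> $$ (j, i))"
        using mat_adjoint_index[of i \<rho> j] d unfolding h by simp
    qed
  next
    assume h: "\<forall>i<n. \<forall>j<n. \<rho> $$ (i, j) = cnj (\<rho> $$ (j, i))"
    show "mat_adjoint \<rho> = \<rho>"
    proof (rule eq_matI)
      fix i j assume ij: "i < dim_row \<rho>" "j < dim_col \<rho>"
      then have "mat_adjoint \<rho> $$ (i, j) = cnj (\<rho> $$ (j, i))"
        using d by (intro mat_adjoint_index) auto
      also have "\<dots> = \<rho> $$ (i, j)" using h[rule_format, of i j] ij d by simp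
      finally show "mat_adjoint \<rho> $$ (i, j) = \<rho> $$ (i, j)" .
    qed (simp_all add: d)
  qed
  ultimately show ?thesis
    unfolding density_def mtrace_def by (simp only: d True simp_thms)
qed (simp add: density_def)

lemma
  assumes "density n \<rho>"
  shows density_carrier: "\<rho> \<in> carrier_mat n n"
    and density_qform_nonneg: "0 \<le> Re (qform n \<rho> v)"
    and density_trace: "(\<Sum>i<n. \<rho> $$ (i, i)) = 1"
  using assms unfolding density_iff_qform by blast+

lemma qform_standard: "i < n \<Longrightarrow> qform n \<rho> (\<lambda>j. if j = i then 1 else 0) = \<rho> $$ (i, i)"
  by (simp add: qform_def if_distrib[of cnj] if_distrib[of "\<lambda>x. x * _"] if_distrib[of "\<lambda>x. _ * x"] cong: if_cong)

lemma density_diag_nonneg: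
  assumes "density n \<rho>" "i < n"
  shows "0 \<le> Re (\<rho> $$ (i, i))"
  using density_qform_nonneg[OF assms(1)] qform_standard[OF assms(2)] by metis

text \<open>The clause on \<open>vN_entropy\<close> is stored with the spectral decomposition so
  that the inequalities below work with \<open>p\<close> and \<open>u\<close> alone, without
  characteristic polynomials.\<close>

definition eigensystem :: "nat \<Rightarrow> complex mat \<Rightarrow> (nat \<Rightarrow> real) \<Rightarrow> (nat \<Rightarrow> nat \<Rightarrow> complex) \<Rightarrow> bool" where
  "eigensystem n \<rho> p u \<longleftrightarrow> onb n u \<and> (\<forall>k<n. 0 \<le> p k) \<and> (\<Sum>k<n. p k) = 1
     \<and> (\<forall>i<n. \<forall>j<n. \<rho> $$ (i, j) = (\<Sum>k<n. complex_of_real (p k) * u k i * cnj (u k j)))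
     \<and> vN_entropy \<rho> = (\<Sum>k<n. entropy_fun (p k))"

lemma eigensystemD:
  assumes "eigensystem n \<rho> p u"
  shows "onb n u" "\<And>k. k < n \<Longrightarrow> 0 \<le> p k" "(\<Sum>k<n. p k) = 1"
    "\<And>i j. i < n \<Longrightarrow> j < n \<Longrightarrow> \<rho> $$ (i, j) = (\<Sum>k<n. complex_of_real (p k) * u k i * cnj (u k j))"
    "vN_entropy \<rho> = (\<Sum>k<n. entropy_fun (p k))"
  using assms unfolding eigensystem_def by blast+

lemma density_eigensystem:
  assumes \<rho>: "density n \<rho>"
  obtains p u where "eigensystem n \<rho> p u"
proof -
  have r: "\<rho> \<in> carrier_mat n n" and h: "mat_adjoint \<rho> = \<rho>" using \<rho> by (auto simp: density_def)
  obtain U where U: "U \<in> carrier_mat n n" and UU: "mat_adjoint U * U = 1\<^sub>m n"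
    and diag: "diagonal_mat (mat_adjoint U * \<rho> * U)"
    using hermitian_unitary_diagonalization[OF r h] by blast
  have Ua: "mat_adjoint U \<in> carrier_mat n n" using U by simp
  have dU: "dim_row U = n" "dim_col U = n" "dim_row \<rho> = n" "dim_col \<rho> = n" using U r by auto
  have UU': "U * mat_adjoint U = 1\<^sub>m n" by (rule mat_mult_left_right_inverse[OF Ua U UU])
  define D where "D = mat_adjoint U * \<rho> * U"
  have D: "D \<in> carrier_mat n n" unfolding D_def using U Ua r by auto
  have dD: "dim_row D = n" "dim_col D = n" using D by auto
  have D0: "D $$ (i, j) = 0" if "i < n" "j < n" "i \<noteq> j" for i j
    using diag that dD unfolding diagonal_mat_def D_def[symmetric] by auto
  have UDU: "U * D * mat_adjoint U = \<rho>"
  proof -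
    have "U * D * mat_adjoint U = (U * mat_adjoint U) * \<rho> * (U * mat_adjoint U)"
      unfolding D_def using U Ua r by (simp add: assoc_mult_mat[of _ n n _ n _ n])
    then show ?thesis using r by (simp add: UU')
  qed
  define u where "u k i = U $$ (i, k)" for k i
  define l where "l k = Re (D $$ (k, k))" for k
  have onb: "onb n u"
    unfolding onb_def
  proof (intro conjI allI impI)
    fix k m assume km: "k < n" "m < n"
    have "(mat_adjoint U * U) $$ (k, m) = (\<Sum>i<n. cnj (u k i) * u m i)"
      using km dU by (simp add: scalar_prod_def u_def lessThan_atLeast0)
    then show "(\<Sum>i<n. cnj (u k i) * u m i) = (if k = m then 1 else 0)" using km by (simp add: UU)
  next
    fix i j assume ij: "i < n" "j < n"
    have "(U * mat_adjoint U) $$ (i, j) = (\<Sum>k<n. u k i * cnj (u k j))"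
      using ij dU by (simp add: scalar_prod_def u_def lessThan_atLeast0)
    then show "(\<Sum>k<n. u k i * cnj (u k j)) = (if i = j then 1 else 0)" using ij by (simp add: UU')
  qed
  \<comment> \<open>The diagonal entries of \<open>D\<close> are values of the quadratic form at the
    columns of \<open>U\<close>, hence nonnegative.\<close>
  have Dq: "D $$ (k, k) = qform n \<rho> (u k)" if "k < n" for k
  proof -
    have "D = mat_adjoint U * (\<rho> * U)"
      unfolding D_def using U Ua r by (simp add: assoc_mult_mat[of _ n n _ n _ n])
    then have "D $$ (k, k) = (mat_adjoint U * (\<rho> * U)) $$ (k, k)" by simp
    also have "\<dots> = (\<Sum>i<n. cnj (u k i) * (\<Sum>j<n. \<rho> $$ (i, j) * u k j))"
      using that dU by (simp add: scalar_prod_def u_def lessThan_atLeast0)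
    finally show ?thesis by (simp add: qform_def sum_distrib_left mult.assoc)
  qed
  have l0: "0 \<le> l k" if "k < n" for k
    unfolding l_def Dq[OF that] by (rule density_qform_nonneg[OF \<rho>])
  have Dh: "mat_adjoint D = D"
    unfolding D_def using U Ua r h
    by (simp add: mat_adjoint_mult[of _ n n _ n] assoc_mult_mat[of _ n n _ n _ n])
  have Dl: "D $$ (k, k) = complex_of_real (l k)" if "k < n" for k
  proof -
    have "cnj (D $$ (k, k)) = D $$ (k, k)"
      using mat_adjoint_index[of k D k] that dD unfolding Dh by simp
    then show ?thesis by (simp add: l_def complex_eq_iff)
  qed
  have ent: "\<rho> $$ (i, j) = (\<Sum>k<n. complex_of_real (l k) * u k i * cnj (u k j))" if ij: "i < n" "j < n" for i j
  proof -
    have "\<rho> $$ (i, j) = (U * D * mat_adjoint U) $$ (i, j)" by (simp add: UDU)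
    also have "\<dots> = (\<Sum>k<n. (\<Sum>m<n. u m i * D $$ (m, k)) * cnj (u k j))"
      using ij dU dD by (simp add: scalar_prod_def u_def lessThan_atLeast0)
    also have "\<dots> = (\<Sum>k<n. complex_of_real (l k) * u k i * cnj (u k j))"
    proof (rule sum.cong[OF refl])
      fix k assume k: "k \<in> {..<n}"
      have "(\<Sum>m<n. u m i * D $$ (m, k)) = (\<Sum>m<n. if m = k then u k i * complex_of_real (l k) else 0)"
        using k D0 Dl by (intro sum.cong) auto
      then show "(\<Sum>m<n. u m i * D $$ (m, k)) * cnj (u k j) = complex_of_real (l k) * u k i * cnj (u k j)"
        using k by simp
    qed
    finally show ?thesis .
  qed
  have "complex_of_real (\<Sum>k<n. l k) = (\<Sum>k<n. complex_of_real (l k) * (\<Sum>i<n. cnj (u k i) * u k i))"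
    using onb by (simp add: onb_def)
  also have "\<dots> = (\<Sum>i<n. \<Sum>k<n. complex_of_real (l k) * u k i * cnj (u k i))"
    by (subst sum.swap) (simp add: sum_distrib_left mult_ac)
  also have "\<dots> = (\<Sum>i<n. \<rho> $$ (i, i))"
    by (intro sum.cong) (auto simp: ent)
  also have "\<dots> = 1" by (rule density_trace[OF \<rho>])
  finally have l1: "(\<Sum>k<n. l k) = 1" by (simp only: of_real_eq_1_iff)
  have "similar_mat_wit \<rho> D U (mat_adjoint U)"
    by (rule similar_mat_witI[of _ _ n]) (use U Ua D r UU UU' UDU in auto)
  then have "similar_mat \<rho> D" by (auto simp: similar_mat_def)
  moreover have "upper_triangular D" using D0 dD by (auto simp: upper_triangular_def)
  ultimately have "vN_entropy \<rho> = (\<Sum>k<n. entropy_fun (Re (D $$ (k, k))))"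
    using r D by (intro vN_entropy_upper_triangular)
  then have "eigensystem n \<rho> l u"
    unfolding eigensystem_def l_def[symmetric] using onb l0 l1 ent by blast
  then show thesis by (rule that)
qed

section \<open>Parseval's identity and quadratic forms of spectral sums\<close>

lemma of_real_cmod_sq: "complex_of_real ((cmod z)\<^sup>2) = z * cnj z"
  by (rule complex_norm_square)

text \<open>A matrix with orthonormal columns preserves norms. Its rows range over an arbitrary set
  \<open>A\<close>, so that the lemma serves both for Parseval's identity and, with pairs of
  indices, for the Stinespring isometry.\<close>

lemma sum_swap_delta:
  fixes z :: "nat \<Rightarrow> complex"
  assumes "\<And>i j. i < n \<Longrightarrow> j < n \<Longrightarrow> (\<Sum>k\<in>A. c k i * cnj (c k j)) = (if i = j then 1 else 0)"
  shows "(\<Sum>k\<in>A. (cmod (\<Sum>i<n. c k i * z i))\<^sup>2) = (\<Sum>i<n. (cmod (z i))\<^sup>2)"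
proof -
  have "complex_of_real (\<Sum>k\<in>A. (cmod (\<Sum>i<n. c k i * z i))\<^sup>2)
    = (\<Sum>k\<in>A. (\<Sum>i<n. c k i * z i) * (\<Sum>j<n. cnj (c k j) * cnj (z j)))"
    by (simp add: of_real_cmod_sq del: of_real_power)
  also have "\<dots> = (\<Sum>k\<in>A. \<Sum>i<n. \<Sum>j<n. z i * cnj (z j) * (c k i * cnj (c k j)))"
    by (simp add: sum_product mult_ac)
  also have "\<dots> = (\<Sum>i<n. \<Sum>j<n. \<Sum>k\<in>A. z i * cnj (z j) * (c k i * cnj (c k j)))"
    by (subst sum.swap, rule sum.cong[OF refl], subst sum.swap, rule refl)
  also have "\<dots> = (\<Sum>i<n. \<Sum>j<n. z i * cnj (z j) * (if i = j then 1 else 0))"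
    by (intro sum.cong refl) (simp add: assms flip: sum_distrib_left)
  also have "\<dots> = complex_of_real (\<Sum>i<n. (cmod (z i))\<^sup>2)"
    by (simp add: of_real_cmod_sq if_distrib[of "\<lambda>x. _ * x"] cong: if_cong del: of_real_power)
  finally show ?thesis by (simp only: of_real_eq_iff)
qed

lemma onb_parseval:
  assumes "onb n u"
  shows "(\<Sum>k<n. (cmod (\<Sum>i<n. u k i * z i))\<^sup>2) = (\<Sum>i<n. (cmod (z i))\<^sup>2)"
    and "(\<Sum>k<n. (cmod (\<Sum>i<n. cnj (u k i) * z i))\<^sup>2) = (\<Sum>i<n. (cmod (z i))\<^sup>2)"
proof -
  show "(\<Sum>k<n. (cmod (\<Sum>i<n. u k i * z i))\<^sup>2) = (\<Sum>i<n. (cmod (z i))\<^sup>2)"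
    using assms by (intro sum_swap_delta) (auto simp: onb_def)
  show "(\<Sum>k<n. (cmod (\<Sum>i<n. cnj (u k i) * z i))\<^sup>2) = (\<Sum>i<n. (cmod (z i))\<^sup>2)"
  proof (rule sum_swap_delta)
    fix i j assume "i < n" "j < n"
    then have "(\<Sum>k<n. u k j * cnj (u k i)) = (if j = i then 1 else 0)"
      using assms by (auto simp: onb_def)
    then show "(\<Sum>k<n. cnj (u k i) * cnj (cnj (u k j))) = (if i = j then 1 else 0)"
      by (auto simp: mult.commute)
  qed
qed

lemma onb_norm:
  assumes "onb n u" "k < n"
  shows "(\<Sum>i<n. (cmod (u k i))\<^sup>2) = 1"
proof -
  have "complex_of_real (\<Sum>i<n. (cmod (u k i))\<^sup>2) = (\<Sum>i<n. cnj (u k i) * u k i)"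
    by (simp add: of_real_cmod_sq mult.commute del: of_real_power)
  then show ?thesis using assms by (simp add: onb_def del: of_real_sum)
qed

lemma onb_standard: "onb n (\<lambda>k i. if i = k then 1 else 0)"
  by (auto simp: onb_def if_distrib[of cnj] if_distrib[of "\<lambda>x. x * _"] if_distrib[of "\<lambda>x. _ * x"] cong: if_cong)

text \<open>Orthogonality of the \<open>u k\<close> is not assumed: besides eigenvectors, the lemma
  is applied to the images of eigenvectors under Kraus operators in
  \<open>cp_map_qform\<close>.\<close>

lemma qform_spectral:
  assumes "\<And>i j. i < n \<Longrightarrow> j < n \<Longrightarrow> \<rho> $$ (i, j) = (\<Sum>k\<in>A. complex_of_real (l k) * u k i * cnj (u k j))"
  shows "qform n \<rho> v = complex_of_real (\<Sum>k\<in>A. l k * (cmod (\<Sum>i<n. cnj (v i) * u k i))\<^sup>2)"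
proof -
  have "qform n \<rho> v = (\<Sum>i<n. \<Sum>j<n. \<Sum>k\<in>A. complex_of_real (l k) * ((cnj (v i) * u k i) * (v j * cnj (u k j))))"
    by (simp add: qform_def assms sum_distrib_left sum_distrib_right mult_ac)
  also have "\<dots> = (\<Sum>k\<in>A. \<Sum>i<n. \<Sum>j<n. complex_of_real (l k) * ((cnj (v i) * u k i) * (v j * cnj (u k j))))"
    by (subst (2) sum.swap, subst sum.swap, rule sum.cong[OF refl], rule sum.cong[OF refl]) simp
  also have "\<dots> = (\<Sum>k\<in>A. complex_of_real (l k) * ((\<Sum>i<n. cnj (v i) * u k i) * cnj (\<Sum>j<n. cnj (v j) * u k j)))"
    by (simp only: cnj_sum complex_cnj_mult complex_cnj_cnj sum_product, simp add: sum_distrib_left)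
  finally show ?thesis by (simp add: of_real_cmod_sq del: of_real_power)
qed

lemma eigensystem_qform:
  assumes E: "eigensystem n \<rho> p u" and l: "l < n"
  shows "qform n \<rho> (u l) = complex_of_real (p l)"
proof -
  have "qform n \<rho> (u l) = complex_of_real (\<Sum>k<n. p k * (cmod (\<Sum>i<n. cnj (u l i) * u k i))\<^sup>2)"
    by (rule qform_spectral[OF eigensystemD(4)[OF E]])
  also have "(\<Sum>k<n. p k * (cmod (\<Sum>i<n. cnj (u l i) * u k i))\<^sup>2) = (\<Sum>k<n. if k = l then p k else 0)"
    using eigensystemD(1)[OF E] l by (intro sum.cong) (auto simp: onb_def)
  finally show ?thesis using l by simp
qed

section \<open>Entropy compared with cross entropy\<close>

lemma cmod_inner_commute: "cmod (\<Sum>i<n. cnj (v i) * w i) = cmod (\<Sum>i<n. cnj (w i) * v i)"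
proof -
  have "(\<Sum>i<n. cnj (v i) * w i) = cnj (\<Sum>i<n. cnj (w i) * v i)" by (simp add: mult.commute)
  then show ?thesis by (simp only: complex_mod_cnj)
qed

text \<open>Klein's inequality, obtained from Jensen's inequality for the weights
  \<open>p\<^sub>k |\<langle>v\<^sub>l, u\<^sub>k\<rangle>|\<^sup>2\<close> where \<open>(p, u)\<close> diagonalizes \<open>\<rho>\<close>.\<close>

lemma vN_entropy_le_cross_entropy:
  assumes \<rho>: "density n \<rho>" and v: "onb n v"
    and s: "\<And>l. l < n \<Longrightarrow> 0 \<le> s l" and s1: "(\<Sum>l<n. s l) \<le> 1"
    and supp: "\<And>l. l < n \<Longrightarrow> s l = 0 \<Longrightarrow> Re (qform n \<rho> (v l)) = 0"
  shows "vN_entropy \<rho> \<le> - (\<Sum>l<n. Re (qform n \<rho> (v l)) * log 2 (s l))"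
proof -
  obtain p u where E: "eigensystem n \<rho> p u"
    by (rule density_eigensystem[OF \<rho>])
  note u = eigensystemD(1)[OF E] and p = eigensystemD(2)[OF E] and p1 = eigensystemD(3)[OF E]
    and ent = eigensystemD(4)[OF E] and S = eigensystemD(5)[OF E]
  \<comment> \<open>These overlaps form a doubly stochastic matrix; \<open>cl\<close> and
    \<open>ck\<close> are Parseval's identity in the two bases.\<close>
  define c where "c k l = (cmod (\<Sum>i<n. cnj (v l i) * u k i))\<^sup>2" for k l
  have c0: "0 \<le> c k l" for k l by (simp add: c_def)
  have cl: "(\<Sum>l<n. c k l) = 1" if "k < n" for k
    unfolding c_def by (simp add: onb_parseval[OF v] onb_norm[OF u that])
  have ck: "(\<Sum>k<n. c k l) = 1" if "l < n" for l
    unfolding c_def cmod_inner_commute[of "v l"] by (simp add: onb_parseval[OF u] onb_norm[OF v that])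
  have q: "Re (qform n \<rho> (v l)) = (\<Sum>k<n. p k * c k l)" for l
    unfolding c_def by (subst qform_spectral[OF ent]) auto
  let ?X = "{..<n} \<times> {..<n}"
  have pos: "0 < p k" "0 < s l" if "k < n" "l < n" "0 < p k * c k l" for k l
  proof -
    show "0 < p k" using that(3) p[OF that(1)] c0[of k l] by (simp add: zero_less_mult_iff)
    \<comment> \<open>If \<open>s l\<close> were zero, \<open>supp\<close> would make this sum
      vanish.\<close>
    have "0 < (\<Sum>k<n. p k * c k l)"
      using that p c0 by (intro sum_pos2[of _ k]) auto
    then show "0 < s l" using q supp[OF that(2)] s[OF that(2)] by (cases "s l = 0") auto
  qed
  have "(\<Sum>x\<in>?X. (p (fst x) * c (fst x) (snd x)) * log 2 (s (snd x) / p (fst x))) \<le> log 2 1"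
  proof (rule sum_weighted_log_le)
    show "(\<Sum>x\<in>?X. p (fst x) * c (fst x) (snd x)) = 1"
      by (simp add: sum.cartesian_product' cl p1 flip: sum_distrib_left)
    \<comment> \<open>Only an inequality: where \<open>p k = 0\<close> the left summand is 0,
      whereas \<open>c k l * s l\<close> may be positive.\<close>
    have "(\<Sum>x\<in>?X. p (fst x) * c (fst x) (snd x) * (s (snd x) / p (fst x))) \<le> (\<Sum>x\<in>?X. c (fst x) (snd x) * s (snd x))"
      using p c0 s by (intro sum_mono) auto
    also have "\<dots> = (\<Sum>l<n. s l)"
      by (simp add: sum.cartesian_product') (subst sum.swap, simp add: ck flip: sum_distrib_right)
    finally show "(\<Sum>x\<in>?X. p (fst x) * c (fst x) (snd x) * (s (snd x) / p (fst x))) \<le> 1" using s1 by simp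
    fix x assume x: "x \<in> ?X"
    show "0 \<le> p (fst x) * c (fst x) (snd x)" using x p c0 by auto
    assume "0 < p (fst x) * c (fst x) (snd x)"
    with x show "0 < s (snd x) / p (fst x)"
      using pos[of "fst x" "snd x"] by (auto intro!: divide_pos_pos)
  qed simp_all
  then have "0 \<ge> (\<Sum>k<n. \<Sum>l<n. p k * c k l * log 2 (s l / p k))"
    by (simp add: sum.cartesian_product')
  also have "(\<Sum>k<n. \<Sum>l<n. p k * c k l * log 2 (s l / p k))
      = (\<Sum>k<n. \<Sum>l<n. p k * c k l * log 2 (s l) - p k * c k l * log 2 (p k))"
  proof (intro sum.cong refl)
    fix k l assume "k \<in> {..<n}" "l \<in> {..<n}"
    then show "p k * c k l * log 2 (s l / p k) = p k * c k l * log 2 (s l) - p k * c k l * log 2 (p k)"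
      using pos[of k l] p[of k] c0[of k l] by (cases "p k * c k l = 0") (auto simp: log_divide algebra_simps less_le)
  qed
  also have "\<dots> = (\<Sum>k<n. \<Sum>l<n. p k * c k l * log 2 (s l)) - (\<Sum>k<n. p k * log 2 (p k) * (\<Sum>l<n. c k l))"
    by (simp add: sum_subtractf sum_distrib_left sum_distrib_right mult_ac)
  also have "(\<Sum>k<n. \<Sum>l<n. p k * c k l * log 2 (s l)) = (\<Sum>l<n. Re (qform n \<rho> (v l)) * log 2 (s l))"
    by (subst sum.swap) (simp add: q sum_distrib_right)
  also have "(\<Sum>k<n. p k * log 2 (p k) * (\<Sum>l<n. c k l)) = - vN_entropy \<rho>"
    by (simp add: cl S entropy_fun_def sum_negf)
  finally show ?thesis by simp
qed

lemma vN_entropy_le_diag_cross_entropy: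
  assumes "density n \<rho>" "\<And>i. i < n \<Longrightarrow> 0 \<le> s i" "(\<Sum>i<n. s i) \<le> 1"
    and "\<And>i. i < n \<Longrightarrow> s i = 0 \<Longrightarrow> Re (\<rho> $$ (i, i)) = 0"
  shows "vN_entropy \<rho> \<le> - (\<Sum>i<n. Re (\<rho> $$ (i, i)) * log 2 (s i))"
  using vN_entropy_le_cross_entropy[OF assms(1) onb_standard assms(2,3)] assms(4)
  by (simp add: qform_standard)

text \<open>The converse estimate uses that \<open>\<rho> \<le> c diag t\<close> forces
  \<open>p \<langle>u, (diag t)\<^sup>-\<^sup>1 u\<rangle> \<le> c\<close> for each eigenpair \<open>(p, u)\<close> of \<open>\<rho>\<close>;
  concavity of the logarithm then does the rest, so operator monotonicity is not needed.\<close>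

lemma cross_entropy_le_vN_entropy:
  assumes \<rho>: "density n \<rho>" and t: "\<And>i. i < n \<Longrightarrow> 0 \<le> t i" and C: "0 < C"
    and bound: "\<And>x. Re (qform n \<rho> x) \<le> C * (\<Sum>i<n. t i * (cmod (x i))\<^sup>2)"
  shows "- (\<Sum>i<n. Re (\<rho> $$ (i, i)) * log 2 (t i)) - log 2 C \<le> vN_entropy \<rho>"
proof -
  obtain p u where E: "eigensystem n \<rho> p u"
    by (rule density_eigensystem[OF \<rho>])
  note u = eigensystemD(1)[OF E] and p = eigensystemD(2)[OF E] and p1 = eigensystemD(3)[OF E]
    and ent = eigensystemD(4)[OF E] and S = eigensystemD(5)[OF E]
  define c where "c k i = (cmod (u k i))\<^sup>2" for k i
  have c0: "0 \<le> c k i" for k i by (simp add: c_def)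
  have ci: "(\<Sum>i<n. c k i) = 1" if "k < n" for k
    unfolding c_def by (rule onb_norm[OF u that])
  have diag: "Re (\<rho> $$ (i, i)) = (\<Sum>k<n. p k * c k i)" if "i < n" for i
  proof -
    have "\<rho> $$ (i, i) = complex_of_real (\<Sum>k<n. p k * c k i)"
      using that by (simp add: ent c_def of_real_cmod_sq mult.assoc del: of_real_power)
    then show ?thesis by simp
  qed
  have pos: "0 < p k" "0 < t i" if "k < n" "i < n" "0 < p k * c k i" for k i
  proof -
    show "0 < p k" using that(3) p[OF that(1)] c0[of k i] by (simp add: zero_less_mult_iff)
    have "0 < Re (\<rho> $$ (i, i))"
      unfolding diag[OF that(2)] using that p c0 by (intro sum_pos2[of _ k]) auto
    also have "Re (\<rho> $$ (i, i)) \<le> C * (\<Sum>j<n. t j * (cmod (if j = i then 1 else 0))\<^sup>2)"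
      using bound[of "\<lambda>j. if j = i then 1 else 0"] that(2) by (simp add: qform_standard)
    also have "\<dots> = C * t i"
      using that(2) by (simp add: if_distrib[of cmod] if_distrib[of "\<lambda>x. x\<^sup>2"] if_distrib[of "\<lambda>x. _ * x"] cong: if_cong)
    finally show "0 < t i" using C by (simp add: zero_less_mult_iff)
  qed
  have eig: "(\<Sum>i<n. c k i * (p k / t i)) \<le> C" if k: "k < n" and pk: "0 < p k" for k
  proof -
    define g where "g = (\<Sum>i<n. c k i / t i)"
    have g0: "0 \<le> g" unfolding g_def using c0 t by (intro sum_nonneg) auto
    have ct: "t i * (c k i / t i / t i) = c k i / t i" for i by simp
    \<comment> \<open>The test vector is the inverse of \<open>diag t\<close> applied to
      \<open>u k\<close>. Keeping only the \<open>k\<close>-th term of the spectral sum,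
      \<open>bound\<close> at \<open>x\<close> gives \<open>p k * g\<^sup>2 \<le> C * g\<close>.
      Division by zero yields 0, so coordinates with \<open>t i = 0\<close> drop out of all these
      sums.\<close>
    define x where "x i = u k i / complex_of_real (t i)" for i
    have xu: "(\<Sum>i<n. cnj (x i) * u k i) = complex_of_real g"
      by (simp add: x_def g_def c_def of_real_cmod_sq mult.commute del: of_real_power)
    have "p k * g\<^sup>2 = p k * (cmod (\<Sum>i<n. cnj (x i) * u k i))\<^sup>2"
      unfolding xu using g0 by simp
    also have "\<dots> \<le> (\<Sum>m<n. p m * (cmod (\<Sum>i<n. cnj (x i) * u m i))\<^sup>2)"
      using k p by (intro member_le_sum) auto
    also have "\<dots> = Re (qform n \<rho> x)"
      by (subst qform_spectral[OF ent]) auto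
    also have "\<dots> \<le> C * (\<Sum>i<n. t i * (cmod (x i))\<^sup>2)" by (rule bound)
    also have "(\<Sum>i<n. t i * (cmod (x i))\<^sup>2) = g"
      unfolding g_def by (intro sum.cong refl) (simp add: x_def c_def norm_divide power_divide power2_eq_square)
    finally have "p k * g * g \<le> C * g" by (simp add: power2_eq_square mult.assoc)
    then have "p k * g \<le> C" using g0 C by (cases "g = 0") auto
    then show ?thesis by (simp add: g_def sum_distrib_left mult_ac)
  qed
  let ?X = "{..<n} \<times> {..<n}"
  have "(\<Sum>x\<in>?X. (p (fst x) * c (fst x) (snd x)) * log 2 (p (fst x) / t (snd x))) \<le> log 2 C"
  proof (rule sum_weighted_log_le)
    show "(\<Sum>x\<in>?X. p (fst x) * c (fst x) (snd x)) = 1"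
      by (simp add: sum.cartesian_product' ci p1 flip: sum_distrib_left)
    have "(\<Sum>x\<in>?X. p (fst x) * c (fst x) (snd x) * (p (fst x) / t (snd x)))
      = (\<Sum>k<n. p k * (\<Sum>i<n. c k i * (p k / t i)))"
      by (simp add: sum.cartesian_product' sum_distrib_left mult.assoc)
    also have "\<dots> \<le> (\<Sum>k<n. p k * C)"
    proof (rule sum_mono)
      fix k assume "k \<in> {..<n}"
      then show "p k * (\<Sum>i<n. c k i * (p k / t i)) \<le> p k * C"
        using p[of k] eig[of k] by (cases "p k = 0") (auto intro!: mult_left_mono)
    qed
    also have "\<dots> = C" by (simp add: p1 flip: sum_distrib_right)
    finally show "(\<Sum>x\<in>?X. p (fst x) * c (fst x) (snd x) * (p (fst x) / t (snd x))) \<le> C" .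
    fix x assume x: "x \<in> ?X"
    show "0 \<le> p (fst x) * c (fst x) (snd x)" using x p c0 by auto
    assume "0 < p (fst x) * c (fst x) (snd x)"
    with x show "0 < p (fst x) / t (snd x)"
      using pos[of "fst x" "snd x"] by (auto intro!: divide_pos_pos)
  qed (simp_all add: C)
  then have "log 2 C \<ge> (\<Sum>k<n. \<Sum>i<n. p k * c k i * log 2 (p k / t i))"
    by (simp add: sum.cartesian_product')
  also have "(\<Sum>k<n. \<Sum>i<n. p k * c k i * log 2 (p k / t i))
      = (\<Sum>k<n. \<Sum>i<n. p k * c k i * log 2 (p k) - p k * c k i * log 2 (t i))"
  proof (intro sum.cong refl)
    fix k i assume "k \<in> {..<n}" "i \<in> {..<n}"
    then show "p k * c k i * log 2 (p k / t i) = p k * c k i * log 2 (p k) - p k * c k i * log 2 (t i)"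
      using pos[of k i] p[of k] c0[of k i] by (cases "p k * c k i = 0") (auto simp: log_divide algebra_simps less_le)
  qed
  also have "\<dots> = (\<Sum>k<n. p k * log 2 (p k) * (\<Sum>i<n. c k i)) - (\<Sum>k<n. \<Sum>i<n. p k * c k i * log 2 (t i))"
    by (simp add: sum_subtractf sum_distrib_left sum_distrib_right mult_ac)
  also have "(\<Sum>k<n. \<Sum>i<n. p k * c k i * log 2 (t i)) = (\<Sum>i<n. Re (\<rho> $$ (i, i)) * log 2 (t i))"
    by (subst sum.swap) (simp add: diag sum_distrib_right)
  also have "(\<Sum>k<n. p k * log 2 (p k) * (\<Sum>i<n. c k i)) = - vN_entropy \<rho>"
    by (simp add: ci S entropy_fun_def sum_negf)
  finally show ?thesis by simp
qed

section \<open>Ensemble averages and concavity of the entropy\<close>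

lemma qform_linear:
  assumes "\<And>i j. i < n \<Longrightarrow> j < n \<Longrightarrow> R $$ (i, j) = (\<Sum>k<m. complex_of_real (p k) * \<rho> k $$ (i, j))"
  shows "qform n R v = (\<Sum>k<m. complex_of_real (p k) * qform n (\<rho> k) v)"
proof -
  have "qform n R v = (\<Sum>i<n. \<Sum>j<n. \<Sum>k<m. complex_of_real (p k) * (cnj (v i) * \<rho> k $$ (i, j) * v j))"
    by (simp add: qform_def assms sum_distrib_left sum_distrib_right mult_ac)
  also have "\<dots> = (\<Sum>k<m. \<Sum>i<n. \<Sum>j<n. complex_of_real (p k) * (cnj (v i) * \<rho> k $$ (i, j) * v j))"
    by (subst (2) sum.swap, subst sum.swap, rule refl)
  finally show ?thesis by (simp add: qform_def sum_distrib_left)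
qed

lemma ens_avg_index: "i < n \<Longrightarrow> j < n \<Longrightarrow> ens_avg n m p \<rho> $$ (i, j) = (\<Sum>k<m. complex_of_real (p k) * \<rho> k $$ (i, j))"
  by (simp add: ens_avg_def)

lemma qform_ens_avg: "Re (qform n (ens_avg n m p \<rho>) v) = (\<Sum>k<m. p k * Re (qform n (\<rho> k) v))"
  using qform_linear[OF ens_avg_index] by simp

lemma density_ens_avg:
  assumes "ensemble n m p \<rho>"
  shows "density n (ens_avg n m p \<rho>)"
proof -
  have d: "0 \<le> p k" "density n (\<rho> k)" if "k < m" for k using assms that by (auto simp: ensemble_def)
  have p1: "(\<Sum>k<m. p k) = 1" using assms by (simp add: ensemble_def)
  have h: "\<rho> k $$ (i, j) = cnj (\<rho> k $$ (j, i))" if "k < m" "i < n" "j < n" for i j k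
    using d(2)[OF that(1)] that(2,3) unfolding density_iff_qform by blast
  have "ens_avg n m p \<rho> $$ (i, j) = cnj (ens_avg n m p \<rho> $$ (j, i))" if "i < n" "j < n" for i j
    using that h[OF _ that(1,2)] by (auto simp: ens_avg_index intro!: sum.cong)
  moreover have "0 \<le> Re (qform n (ens_avg n m p \<rho>) v)" for v
    unfolding qform_ens_avg using d by (intro sum_nonneg) (auto simp: density_qform_nonneg)
  moreover have "(\<Sum>i<n. ens_avg n m p \<rho> $$ (i, i)) = 1"
  proof -
    have "(\<Sum>i<n. ens_avg n m p \<rho> $$ (i, i)) = (\<Sum>k<m. complex_of_real (p k) * (\<Sum>i<n. \<rho> k $$ (i, i)))"
      by (simp add: ens_avg_index sum_distrib_left) (rule sum.swap)
    also have "\<dots> = (\<Sum>k<m. complex_of_real (p k))"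
      using d by (intro sum.cong) (auto simp: density_trace)
    also have "\<dots> = 1" using p1 by (simp flip: of_real_sum)
    finally show ?thesis .
  qed
  moreover have "ens_avg n m p \<rho> \<in> carrier_mat n n" by (simp add: ens_avg_def)
  ultimately show ?thesis unfolding density_iff_qform by blast
qed

text \<open>Klein's inequality compares every member with the eigensystem of the average. Cross
  entropy is linear in the state, so the mean of these bounds is exactly the entropy of the average.
  Members of probability 0 are split off, since their support is not controlled by that of the
  average.\<close>

lemma vN_entropy_concave:
  assumes e: "ensemble n m p \<rho>"
  shows "(\<Sum>k<m. p k * vN_entropy (\<rho> k)) \<le> vN_entropy (ens_avg n m p \<rho>)"
proof -
  have d: "0 \<le> p k" "density n (\<rho> k)" if "k < m" for k using e that by (auto simp: ensemble_def)
  let ?R = "ens_avg n m p \<rho>"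
  obtain s v where E: "eigensystem n ?R s v"
    by (rule density_eigensystem[OF density_ens_avg[OF e]])
  note v = eigensystemD(1)[OF E] and s = eigensystemD(2)[OF E] and s1 = eigensystemD(3)[OF E]
    and ent = eigensystemD(4)[OF E] and S = eigensystemD(5)[OF E]
  have q: "Re (qform n ?R (v l)) = s l" if "l < n" for l
    using eigensystem_qform[OF E that] by simp
  have "p k * vN_entropy (\<rho> k) \<le> p k * (- (\<Sum>l<n. Re (qform n (\<rho> k) (v l)) * log 2 (s l)))" if k: "k < m" for k
  proof (cases "p k = 0")
    case False
    then have pk: "0 < p k" using d(1)[OF k] by simp
    show ?thesis
    proof (intro mult_left_mono d(1)[OF k] vN_entropy_le_cross_entropy[OF d(2)[OF k] v s])
      fix l assume l: "l < n" "s l = 0"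
      have "p k * Re (qform n (\<rho> k) (v l)) \<le> (\<Sum>k<m. p k * Re (qform n (\<rho> k) (v l)))"
        using k d by (intro member_le_sum) (auto simp: density_qform_nonneg)
      also have "\<dots> = 0" using q[OF l(1)] l(2) by (simp add: qform_ens_avg)
      finally have "Re (qform n (\<rho> k) (v l)) \<le> 0" using pk by (simp add: mult_le_0_iff)
      then show "Re (qform n (\<rho> k) (v l)) = 0" using density_qform_nonneg[OF d(2)[OF k]] by (intro antisym)
    qed (auto simp: s1)
  qed simp
  then have "(\<Sum>k<m. p k * vN_entropy (\<rho> k)) \<le> (\<Sum>k<m. p k * (- (\<Sum>l<n. Re (qform n (\<rho> k) (v l)) * log 2 (s l))))"
    by (intro sum_mono) auto
  also have "\<dots> = - (\<Sum>l<n. (\<Sum>k<m. p k * Re (qform n (\<rho> k) (v l))) * log 2 (s l))"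
    by (simp add: sum_negf sum_distrib_left sum_distrib_right mult.assoc) (rule sum.swap)
  also have "\<dots> = vN_entropy ?R"
    by (simp add: S entropy_fun_def sum_negf q flip: qform_ens_avg)
  finally show ?thesis .
qed

subsection \<open>Channels given by Stinespring dilations\<close>

text \<open>\<open>X\<close> is the system kept and \<open>Y\<close> the one traced out, so the
  slices of \<open>K\<close> at fixed \<open>y\<close> are Kraus operators.\<close>

definition cp_map :: "nat \<Rightarrow> nat \<Rightarrow> nat \<Rightarrow> (nat \<Rightarrow> nat \<Rightarrow> nat \<Rightarrow> complex) \<Rightarrow> complex mat \<Rightarrow> complex mat" where
  "cp_map n dX dY K \<rho> = mat dX dX (\<lambda>(x, x').
     \<Sum>y<dY. \<Sum>a<n. \<Sum>a'<n. K x y a * \<rho> $$ (a, a') * cnj (K x' y a'))"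

definition isometric :: "nat \<Rightarrow> nat \<Rightarrow> nat \<Rightarrow> (nat \<Rightarrow> nat \<Rightarrow> nat \<Rightarrow> complex) \<Rightarrow> bool" where
  "isometric n dX dY K \<longleftrightarrow> (\<forall>a<n. \<forall>a'<n.
     (\<Sum>x<dX. \<Sum>y<dY. K x y a * cnj (K x y a')) = (if a = a' then 1 else 0))"

text \<open>The array \<open>K b e a\<close> holds the amplitude \<open>\<langle>b, e| V |a\<rangle>\<close> of the isometry; exchanging its first
  two arguments exchanges a channel with its complement.\<close>

definition dilation ::
  "stinespring \<Rightarrow> nat \<Rightarrow> nat \<Rightarrow> nat \<Rightarrow> (nat \<Rightarrow> nat \<Rightarrow> nat \<Rightarrow> complex) \<Rightarrow> bool" where
  "dilation N n dB dE K \<longleftrightarrow> fst N = dB \<and> fst (snd N) = dE \<and> snd (snd N) \<in> carrier_mat (dB * dE) n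
     \<and> (\<forall>b<dB. \<forall>e<dE. \<forall>a<n. snd (snd N) $$ (b * dE + e, a) = K b e a) \<and> isometric n dB dE K"

lemma mixed_radix_less:
  fixes b e :: nat
  assumes "b < B" "e < E"
  shows "b * E + e < B * E"
proof -
  have "b * E + e < Suc b * E" using assms by simp
  also have "\<dots> \<le> B * E" using assms by (intro mult_le_mono1) simp
  finally show ?thesis .
qed

lemma isometric_swap:
  assumes "isometric n dX dY K"
  shows "isometric n dY dX (\<lambda>y x. K x y)"
  using assms unfolding isometric_def by (subst sum.swap)

lemma dilation_in_dim: "dilation N n dB dE K \<Longrightarrow> in_dim N = n"
  by (auto simp: dilation_def in_dim_def)

lemma conjugation_index:
  assumes V: "V \<in> carrier_mat m n" and r: "\<rho> \<in> carrier_mat n n" and ij: "i < m" "j < m"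
  shows "(V * \<rho> * mat_adjoint V) $$ (i, j) = (\<Sum>a<n. \<Sum>a'<n. V $$ (i, a) * \<rho> $$ (a, a') * cnj (V $$ (j, a')))"
proof -
  have d: "dim_row V = m" "dim_col V = n" "dim_row \<rho> = n" "dim_col \<rho> = n" using V r by auto
  have "(V * \<rho> * mat_adjoint V) $$ (i, j) = (\<Sum>a'<n. (\<Sum>a<n. V $$ (i, a) * \<rho> $$ (a, a')) * cnj (V $$ (j, a')))"
    using ij d by (simp add: scalar_prod_def lessThan_atLeast0)
  then show ?thesis by (simp add: sum_distrib_right) (rule sum.swap)
qed

lemma dilation_channel:
  assumes N: "dilation N n dB dE K" and r: "\<rho> \<in> carrier_mat n n"
  shows "channel N \<rho> = cp_map n dB dE K \<rho>" "compl_channel N \<rho> = cp_map n dE dB (\<lambda>e b. K b e) \<rho>"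
proof -
  obtain V where V: "V \<in> carrier_mat (dB * dE) n" and NV: "N = (dB, dE, V)"
    and K: "\<And>b e a. b < dB \<Longrightarrow> e < dE \<Longrightarrow> a < n \<Longrightarrow> V $$ (b * dE + e, a) = K b e a"
    using N by (cases N) (auto simp: dilation_def)
  have *: "(V * \<rho> * mat_adjoint V) $$ (b * dE + e, b' * dE + e')
    = (\<Sum>a<n. \<Sum>a'<n. K b e a * \<rho> $$ (a, a') * cnj (K b' e' a'))"
    if "b < dB" "e < dE" "b' < dB" "e' < dE" for b e b' e'
    using that by (simp add: conjugation_index[OF V r] mixed_radix_less K)
  show "channel N \<rho> = cp_map n dB dE K \<rho>" "compl_channel N \<rho> = cp_map n dE dB (\<lambda>e b. K b e) \<rho>"
    by (auto simp: NV channel_def compl_channel_def ptrace_E_def ptrace_B_def cp_map_def * intro!: cong_mat sum.cong)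
qed

text \<open>Each Kraus operator sends each eigenvector to one vector, and the output is the mixture
  of these vectors indexed by pairs \<open>(y, k)\<close>. They are neither normalised nor
  orthogonal in general.\<close>

lemma cp_map_spectral:
  assumes E: "eigensystem n \<rho> p u" and x: "x < dX" "x' < dX"
  shows "cp_map n dX dY K \<rho> $$ (x, x') = (\<Sum>yk\<in>{..<dY} \<times> {..<n}. complex_of_real (p (snd yk))
    * (\<Sum>a<n. K x (fst yk) a * u (snd yk) a) * cnj (\<Sum>a<n. K x' (fst yk) a * u (snd yk) a))"
proof -
  have "cp_map n dX dY K \<rho> $$ (x, x') = (\<Sum>y<dY. \<Sum>a<n. \<Sum>a'<n. \<Sum>k<n.
      complex_of_real (p k) * ((K x y a * u k a) * (cnj (K x' y a') * cnj (u k a'))))"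
    using x by (simp add: cp_map_def eigensystemD(4)[OF E] sum_distrib_left sum_distrib_right mult_ac)
  also have "\<dots> = (\<Sum>y<dY. \<Sum>k<n. \<Sum>a<n. \<Sum>a'<n.
      complex_of_real (p k) * ((K x y a * u k a) * (cnj (K x' y a') * cnj (u k a'))))"
    by (rule sum.cong[OF refl], subst (2) sum.swap, subst sum.swap, rule refl)
  also have "\<dots> = (\<Sum>y<dY. \<Sum>k<n. complex_of_real (p k)
      * ((\<Sum>a<n. K x y a * u k a) * (\<Sum>a'<n. cnj (K x' y a') * cnj (u k a'))))"
    by (simp only: sum_product, simp only: sum_distrib_left)
  finally show ?thesis by (simp add: sum.cartesian_product' mult.assoc)
qed

lemma cp_map_qform:
  assumes E: "eigensystem n \<rho> p u"
  shows "qform dX (cp_map n dX dY K \<rho>) v = complex_of_real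
    (\<Sum>y<dY. \<Sum>k<n. p k * (cmod (\<Sum>x<dX. cnj (v x) * (\<Sum>a<n. K x y a * u k a)))\<^sup>2)"
  using qform_spectral[where u="\<lambda>yk x. \<Sum>a<n. K x (fst yk) a * u (snd yk) a" and l="\<lambda>yk. p (snd yk)",
      OF cp_map_spectral[OF E]]
  by (simp add: sum.cartesian_product')

lemma density_cp_map:
  assumes \<rho>: "density n \<rho>" and K: "isometric n dX dY K"
  shows "density dX (cp_map n dX dY K \<rho>)"
proof -
  obtain p u where E: "eigensystem n \<rho> p u" by (rule density_eigensystem[OF \<rho>])
  let ?R = "cp_map n dX dY K \<rho>"
  have h: "?R $$ (x, x') = cnj (?R $$ (x', x))" if "x < dX" "x' < dX" for x x'
    unfolding cp_map_spectral[OF E that] cp_map_spectral[OF E that(2,1)] by (simp add: mult_ac)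
  have q: "0 \<le> Re (qform dX ?R v)" for v
    unfolding cp_map_qform[OF E] using eigensystemD(2)[OF E] by (auto intro!: sum_nonneg)
  have "(\<Sum>x<dX. ?R $$ (x, x)) = (\<Sum>x<dX. \<Sum>y<dY. \<Sum>a<n. \<Sum>a'<n. \<rho> $$ (a, a') * (K x y a * cnj (K x y a')))"
    by (simp add: cp_map_def mult_ac)
  also have "\<dots> = (\<Sum>x<dX. \<Sum>a<n. \<Sum>a'<n. \<Sum>y<dY. \<rho> $$ (a, a') * (K x y a * cnj (K x y a')))"
    by (rule sum.cong[OF refl], subst sum.swap, rule sum.cong[OF refl], rule sum.swap)
  also have "\<dots> = (\<Sum>a<n. \<Sum>a'<n. \<Sum>x<dX. \<Sum>y<dY. \<rho> $$ (a, a') * (K x y a * cnj (K x y a')))"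
    by (subst sum.swap, rule sum.cong[OF refl], rule sum.swap)
  also have "\<dots> = (\<Sum>a<n. \<Sum>a'<n. \<rho> $$ (a, a') * (if a = a' then 1 else 0))"
    using K by (simp add: isometric_def flip: sum_distrib_left)
  also have "\<dots> = (\<Sum>a<n. \<rho> $$ (a, a))"
    by (simp add: if_distrib[of "\<lambda>x. _ * x"] cong: if_cong)
  also have "\<dots> = 1" by (rule density_trace[OF \<rho>])
  finally have t: "(\<Sum>x<dX. ?R $$ (x, x)) = 1" .
  have c: "?R \<in> carrier_mat dX dX" by (simp add: cp_map_def)
  show ?thesis unfolding density_iff_qform using h q t c by blast
qed

lemma cp_map_ens_avg:
  "cp_map n dX dY K (ens_avg n m p \<rho>) = ens_avg dX m p (\<lambda>i. cp_map n dX dY K (\<rho> i))"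
proof (rule eq_matI)
  fix x x' assume "x < dim_row (ens_avg dX m p (\<lambda>i. cp_map n dX dY K (\<rho> i)))"
    "x' < dim_col (ens_avg dX m p (\<lambda>i. cp_map n dX dY K (\<rho> i)))"
  then have x: "x < dX" "x' < dX" by (auto simp: ens_avg_def)
  have "cp_map n dX dY K (ens_avg n m p \<rho>) $$ (x, x') = (\<Sum>y<dY. \<Sum>a<n. \<Sum>a'<n. \<Sum>i<m.
      complex_of_real (p i) * (K x y a * \<rho> i $$ (a, a') * cnj (K x' y a')))"
    using x by (simp add: cp_map_def ens_avg_def sum_distrib_left sum_distrib_right mult_ac)
  also have "\<dots> = (\<Sum>y<dY. \<Sum>a<n. \<Sum>i<m. \<Sum>a'<n. complex_of_real (p i) * (K x y a * \<rho> i $$ (a, a') * cnj (K x' y a')))"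
    by (rule sum.cong[OF refl], rule sum.cong[OF refl], rule sum.swap)
  also have "\<dots> = (\<Sum>y<dY. \<Sum>i<m. \<Sum>a<n. \<Sum>a'<n. complex_of_real (p i) * (K x y a * \<rho> i $$ (a, a') * cnj (K x' y a')))"
    by (rule sum.cong[OF refl], rule sum.swap)
  also have "\<dots> = (\<Sum>i<m. \<Sum>y<dY. \<Sum>a<n. \<Sum>a'<n. complex_of_real (p i) * (K x y a * \<rho> i $$ (a, a') * cnj (K x' y a')))"
    by (rule sum.swap)
  also have "\<dots> = ens_avg dX m p (\<lambda>i. cp_map n dX dY K (\<rho> i)) $$ (x, x')"
    using x by (simp add: cp_map_def ens_avg_def sum_distrib_left)
  finally show "cp_map n dX dY K (ens_avg n m p \<rho>) $$ (x, x') = ens_avg dX m p (\<lambda>i. cp_map n dX dY K (\<rho> i)) $$ (x, x')" .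
qed (auto simp: cp_map_def ens_avg_def)

lemma ensemble_cp_map:
  assumes "ensemble n m p \<rho>" "isometric n dX dY K"
  shows "ensemble dX m p (\<lambda>i. cp_map n dX dY K (\<rho> i))"
  using assms density_cp_map by (auto simp: ensemble_def)

section \<open>Holevo and private information through dilations\<close>

lemma ensemble_carrier:
  assumes "ensemble n m p \<rho>"
  shows "ens_avg n m p \<rho> \<in> carrier_mat n n" "\<And>i. i < m \<Longrightarrow> \<rho> i \<in> carrier_mat n n"
  using assms by (auto simp: ensemble_def ens_avg_def dest: density_carrier)

lemma holevo_ens_eq:
  assumes N: "dilation N n dB dE K" and e: "ensemble n m p \<rho>"
  shows "holevo_ens N m p \<rho> = vN_entropy (ens_avg dB m p (\<lambda>i. cp_map n dB dE K (\<rho> i)))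
    - (\<Sum>i<m. p i * vN_entropy (cp_map n dB dE K (\<rho> i)))"
  using ensemble_carrier[OF e] dilation_channel(1)[OF N]
  by (simp add: holevo_ens_def dilation_in_dim[OF N] cp_map_ens_avg)

text \<open>Coherent information is a difference of entropies, so the environment terms collect into
  a Holevo quantity of their own. Concavity makes it nonnegative for every ensemble, and it vanishes
  for the code ensembles.\<close>

lemma private_info_ens_eq:
  assumes N: "dilation N n dB dE K" and e: "ensemble n m p \<rho>"
  shows "private_info_ens N m p \<rho> = holevo_ens N m p \<rho>
    - (vN_entropy (ens_avg dE m p (\<lambda>i. cp_map n dE dB (\<lambda>e b. K b e) (\<rho> i)))
       - (\<Sum>i<m. p i * vN_entropy (cp_map n dE dB (\<lambda>e b. K b e) (\<rho> i))))"
proof -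
  have 1: "(\<Sum>i<m. p i * coherent_info (\<rho> i) N)
    = (\<Sum>i<m. p i * vN_entropy (channel N (\<rho> i))) - (\<Sum>i<m. p i * vN_entropy (compl_channel N (\<rho> i)))"
    by (simp add: coherent_info_def right_diff_distrib sum_subtractf)
  have 2: "compl_channel N (ens_avg n m p \<rho>) = ens_avg dE m p (\<lambda>i. cp_map n dE dB (\<lambda>e b. K b e) (\<rho> i))"
    unfolding dilation_channel(2)[OF N ensemble_carrier(1)[OF e]] by (rule cp_map_ens_avg)
  have 3: "(\<Sum>i<m. p i * vN_entropy (compl_channel N (\<rho> i)))
    = (\<Sum>i<m. p i * vN_entropy (cp_map n dE dB (\<lambda>e b. K b e) (\<rho> i)))"
  proof (rule sum.cong[OF refl])
    fix i assume "i \<in> {..<m}"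
    then have "\<rho> i \<in> carrier_mat n n" using ensemble_carrier(2)[OF e] by blast
    from dilation_channel(2)[OF N this]
    show "p i * vN_entropy (compl_channel N (\<rho> i)) = p i * vN_entropy (cp_map n dE dB (\<lambda>e b. K b e) (\<rho> i))"
      by (rule arg_cong[where f="\<lambda>X. p i * vN_entropy X"])
  qed
  show ?thesis
    unfolding private_info_ens_def holevo_ens_def dilation_in_dim[OF N] 1
    unfolding coherent_info_def 2 3 by linarith
qed

lemma private_info_ens_le_holevo_ens:
  assumes N: "dilation N n dB dE K" and e: "ensemble n m p \<rho>"
  shows "private_info_ens N m p \<rho> \<le> holevo_ens N m p \<rho>"
proof -
  have "isometric n dE dB (\<lambda>e b. K b e)"
    by (rule isometric_swap) (use N in \<open>simp add: dilation_def\<close>)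
  from vN_entropy_concave[OF ensemble_cp_map[OF e this]] show ?thesis
    by (simp add: private_info_ens_eq[OF N e])
qed

text \<open>The entropy of the mean output is at most its cross entropy with \<open>t\<close>, and
  each single output has at least its cross entropy minus \<open>log 2 C\<close>. By linearity the
  cross entropies cancel in the mean, leaving \<open>log 2 C\<close>.\<close>

lemma holevo_ens_le_log:
  assumes N: "dilation N n dB dE K" and e: "ensemble n m p \<rho>"
    and t: "\<And>i. i < dB \<Longrightarrow> 0 \<le> t i" and t1: "(\<Sum>i<dB. t i) \<le> 1" and C: "0 < C"
    and bound: "\<And>\<sigma> x. density n \<sigma> \<Longrightarrow> Re (qform dB (cp_map n dB dE K \<sigma>) x) \<le> C * (\<Sum>i<dB. t i * (cmod (x i))\<^sup>2)"
  shows "holevo_ens N m p \<rho> \<le> log 2 C"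
proof -
  define R where "R i = cp_map n dB dE K (\<rho> i)" for i
  have K: "isometric n dB dE K" using N by (simp add: dilation_def)
  have eR: "ensemble dB m p R" unfolding R_def by (rule ensemble_cp_map[OF e K])
  have d: "0 \<le> p i" "density n (\<rho> i)" "density dB (R i)" if "i < m" for i
    using e eR that by (auto simp: ensemble_def)
  have p1: "(\<Sum>i<m. p i) = 1" using e by (simp add: ensemble_def)
  let ?A = "ens_avg dB m p R"
  have A: "density dB ?A" by (rule density_ens_avg[OF eR])
  have diag: "Re (?A $$ (j, j)) = (\<Sum>i<m. p i * Re (R i $$ (j, j)))" if "j < dB" for j
    using that by (simp add: ens_avg_index)
  have "vN_entropy ?A \<le> - (\<Sum>j<dB. Re (?A $$ (j, j)) * log 2 (t j))"
  proof (rule vN_entropy_le_diag_cross_entropy[OF A t t1])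
    fix j assume j: "j < dB" "t j = 0"
    \<comment> \<open>A zero weight forces a zero diagonal entry: evaluate \<open>bound\<close> at
      the basis vector \<open>j\<close>.\<close>
    have "Re (R i $$ (j, j)) = 0" if i: "i < m" for i
    proof -
      have "Re (R i $$ (j, j)) \<le> C * (\<Sum>k<dB. t k * (cmod (if k = j then 1 else 0))\<^sup>2)"
        using bound[OF d(2)[OF i], of "\<lambda>k. if k = j then 1 else 0"] j by (simp add: qform_standard R_def)
      also have "(\<Sum>k<dB. t k * (cmod (if k = j then 1 else 0))\<^sup>2) = 0"
        using j by (intro sum.neutral) auto
      finally show ?thesis using density_diag_nonneg[OF d(3)[OF i] j(1)] by simp
    qed
    then show "Re (?A $$ (j, j)) = 0" using j by (simp add: diag)
  qed
  moreover have "(\<Sum>i<m. p i * (- (\<Sum>j<dB. Re (R i $$ (j, j)) * log 2 (t j)) - log 2 C)) \<le> (\<Sum>i<m. p i * vN_entropy (R i))"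
    using d bound by (intro sum_mono mult_left_mono cross_entropy_le_vN_entropy t C) (auto simp: R_def)
  moreover have "(\<Sum>i<m. p i * (- (\<Sum>j<dB. Re (R i $$ (j, j)) * log 2 (t j)) - log 2 C))
    = - (\<Sum>j<dB. Re (?A $$ (j, j)) * log 2 (t j)) - log 2 C"
  proof -
    have "(\<Sum>i<m. p i * (- (\<Sum>j<dB. Re (R i $$ (j, j)) * log 2 (t j)) - log 2 C))
      = - (\<Sum>i<m. \<Sum>j<dB. p i * Re (R i $$ (j, j)) * log 2 (t j)) - (\<Sum>i<m. p i) * log 2 C"
      by (simp add: right_diff_distrib sum_subtractf sum_negf sum_distrib_left sum_distrib_right mult.assoc)
    also have "(\<Sum>i<m. \<Sum>j<dB. p i * Re (R i $$ (j, j)) * log 2 (t j)) = (\<Sum>j<dB. Re (?A $$ (j, j)) * log 2 (t j))"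
      by (subst sum.swap) (simp add: diag sum_distrib_right)
    finally show ?thesis by (simp add: p1)
  qed
  ultimately show ?thesis unfolding holevo_ens_eq[OF N e] R_def[symmetric] by simp
qed

text \<open>Equivalently, every output of the channel is bounded by \<open>diag t\<close> (lemma \<open>bilinear_bounded_qform\<close>).
  Stated as a bound on \<open>V\<^sup>*\<close> at product vectors \<open>x \<otimes> y\<close>, the property is accessible to
  induction over tensor powers.\<close>

definition bilinear_bounded ::
  "nat \<Rightarrow> nat \<Rightarrow> nat \<Rightarrow> (nat \<Rightarrow> nat \<Rightarrow> nat \<Rightarrow> complex) \<Rightarrow> (nat \<Rightarrow> real) \<Rightarrow> bool" where
  "bilinear_bounded n dB dE K t \<longleftrightarrow> (\<forall>i<dB. 0 \<le> t i) \<and> (\<forall>x y.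
     (\<Sum>a<n. (cmod (\<Sum>b<dB. \<Sum>e<dE. x b * y e * K b e a))\<^sup>2)
       \<le> (\<Sum>b<dB. t b * (cmod (x b))\<^sup>2) * (\<Sum>e<dE. (cmod (y e))\<^sup>2))"

text \<open>For fixed \<open>x\<close>, the sums inside \<open>cmod\<close> are the components
  \<open>z e\<close> of a vector on the environment. Choosing \<open>y\<close> as the conjugate of
  \<open>z\<close> turns its squared norm \<open>Z\<close> into the bilinear expression paired with
  \<open>u\<close>; Cauchy-Schwarz gives \<open>Z\<^sup>2 \<le> T * Z * U\<close>, and
  \<open>Z\<close> is cancelled.\<close>

lemma bilinear_bounded_dual:
  assumes "bilinear_bounded n dB dE K t"
  shows "(\<Sum>e<dE. (cmod (\<Sum>b<dB. x b * (\<Sum>a<n. K b e a * u a)))\<^sup>2)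
    \<le> (\<Sum>b<dB. t b * (cmod (x b))\<^sup>2) * (\<Sum>a<n. (cmod (u a))\<^sup>2)"
proof -
  define z where "z e = (\<Sum>b<dB. x b * (\<Sum>a<n. K b e a * u a))" for e
  define Z where "Z = (\<Sum>e<dE. (cmod (z e))\<^sup>2)"
  define T where "T = (\<Sum>b<dB. t b * (cmod (x b))\<^sup>2)"
  define U where "U = (\<Sum>a<n. (cmod (u a))\<^sup>2)"
  have Z0: "0 \<le> Z" by (simp add: Z_def sum_nonneg)
  have U0: "0 \<le> U" by (simp add: U_def sum_nonneg)
  have T0: "0 \<le> T" using assms by (auto simp: T_def bilinear_bounded_def intro!: sum_nonneg)
  have zw: "z e * w = (\<Sum>b<dB. \<Sum>a<n. (x b * w * K b e a) * u a)" for e w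
    by (simp add: z_def sum_distrib_left sum_distrib_right mult_ac)
  have "complex_of_real Z = (\<Sum>e<dE. \<Sum>b<dB. \<Sum>a<n. (x b * cnj (z e) * K b e a) * u a)"
    by (simp add: Z_def of_real_cmod_sq zw del: of_real_power)
  also have "\<dots> = (\<Sum>e<dE. \<Sum>a<n. \<Sum>b<dB. (x b * cnj (z e) * K b e a) * u a)"
    by (rule sum.cong[OF refl], rule sum.swap)
  also have "\<dots> = (\<Sum>a<n. \<Sum>b<dB. \<Sum>e<dE. (x b * cnj (z e) * K b e a) * u a)"
    by (subst sum.swap, rule sum.cong[OF refl], rule sum.swap)
  also have "\<dots> = (\<Sum>a<n. (\<Sum>b<dB. \<Sum>e<dE. x b * cnj (z e) * K b e a) * u a)"
    by (simp add: sum_distrib_right)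
  finally have "cmod (complex_of_real Z) = cmod (\<Sum>a<n. (\<Sum>b<dB. \<Sum>e<dE. x b * cnj (z e) * K b e a) * u a)"
    by (rule arg_cong)
  then have Z: "Z = cmod (\<Sum>a<n. (\<Sum>b<dB. \<Sum>e<dE. x b * cnj (z e) * K b e a) * u a)"
    using Z0 by (simp only: norm_of_real abs_of_nonneg)
  have "Z\<^sup>2 \<le> (\<Sum>a<n. (cmod (\<Sum>b<dB. \<Sum>e<dE. x b * cnj (z e) * K b e a))\<^sup>2) * U"
    unfolding U_def by (subst Z) (rule cmod_sum_mult_le)
  also have "\<dots> \<le> (T * (\<Sum>e<dE. (cmod (cnj (z e)))\<^sup>2)) * U"
    unfolding T_def
    using assms[unfolded bilinear_bounded_def, THEN conjunct2, rule_format, of x "\<lambda>e. cnj (z e)"]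
    by (rule mult_right_mono[OF _ U0])
  also have "\<dots> = T * Z * U" by (simp add: Z_def)
  finally have "Z * Z \<le> (T * U) * Z" by (simp add: power2_eq_square mult_ac)
  then have "Z \<le> T * U" using Z0 T0 U0 by (cases "Z = 0") auto
  then show ?thesis by (simp add: Z_def T_def U_def z_def)
qed

lemma bilinear_bounded_qform:
  assumes b: "bilinear_bounded n dB dE K t" and \<rho>: "density n \<rho>"
  shows "Re (qform dB (cp_map n dB dE K \<rho>) x) \<le> (\<Sum>b<dB. t b * (cmod (x b))\<^sup>2)"
proof -
  obtain p u where E: "eigensystem n \<rho> p u" by (rule density_eigensystem[OF \<rho>])
  have "Re (qform dB (cp_map n dB dE K \<rho>) x)
    = (\<Sum>k<n. p k * (\<Sum>e<dE. (cmod (\<Sum>b<dB. cnj (x b) * (\<Sum>a<n. K b e a * u k a)))\<^sup>2))"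
    unfolding cp_map_qform[OF E] by (subst sum.swap) (simp add: sum_distrib_left)
  also have "\<dots> \<le> (\<Sum>k<n. p k * (\<Sum>b<dB. t b * (cmod (x b))\<^sup>2))"
  proof (intro sum_mono mult_left_mono)
    fix k assume "k \<in> {..<n}"
    then show "(\<Sum>e<dE. (cmod (\<Sum>b<dB. cnj (x b) * (\<Sum>a<n. K b e a * u k a)))\<^sup>2) \<le> (\<Sum>b<dB. t b * (cmod (x b))\<^sup>2)"
      using bilinear_bounded_dual[OF b, of "\<lambda>b. cnj (x b)" "u k"] onb_norm[OF eigensystemD(1)[OF E], of k] by simp
  qed (use eigensystemD(2)[OF E] in auto)
  also have "\<dots> = (\<Sum>b<dB. t b * (cmod (x b))\<^sup>2)"
    by (simp add: eigensystemD(3)[OF E] flip: sum_distrib_right)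
  finally show ?thesis .
qed

text \<open>The reference distribution is \<open>t / S\<close>; dividing \<open>t\<close> by
  \<open>S\<close> costs the factor \<open>S\<close> in the operator bound, and this factor is the
  whole rate.\<close>

lemma holevo_ens_le_of_bilinear_bounded:
  assumes N: "dilation N n dB dE K" and b: "bilinear_bounded n dB dE K t"
    and s: "(\<Sum>i<dB. t i) \<le> S" "0 < S" and e: "ensemble n m p \<rho>"
  shows "holevo_ens N m p \<rho> \<le> log 2 S"
proof (rule holevo_ens_le_log[OF N e, where t="\<lambda>i. t i / S"])
  show "0 \<le> t i / S" if "i < dB" for i using b s that by (auto simp: bilinear_bounded_def)
  show "(\<Sum>i<dB. t i / S) \<le> 1" using s by (simp flip: sum_divide_distrib)
  show "0 < S" by fact
  fix \<sigma> x assume "density n \<sigma>"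
  from bilinear_bounded_qform[OF b this, of x]
  show "Re (qform dB (cp_map n dB dE K \<sigma>) x) \<le> S * (\<Sum>i<dB. t i / S * (cmod (x i))\<^sup>2)"
    using s by (simp add: sum_distrib_left)
qed

section \<open>Tensor products and powers of dilations\<close>

definition kraus_tensor ::
  "nat \<Rightarrow> nat \<Rightarrow> nat \<Rightarrow> (nat \<Rightarrow> nat \<Rightarrow> nat \<Rightarrow> complex) \<Rightarrow> (nat \<Rightarrow> nat \<Rightarrow> nat \<Rightarrow> complex) \<Rightarrow> nat \<Rightarrow> nat \<Rightarrow> nat \<Rightarrow> complex" where
  "kraus_tensor n dB dE K1 K2 b e a
    = K1 (b div dB) (e div dE) (a div n) * K2 (b mod dB) (e mod dE) (a mod n)"

lemma mixed_radix_div_mod: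
  fixes i j n :: nat
  assumes "j < n"
  shows "(i * n + j) div n = i" "(i * n + j) mod n = j"
  using assms by (auto simp: div_add1_eq)

lemma sum_tensor:
  fixes f g :: "nat \<Rightarrow> nat \<Rightarrow> 'a::comm_semiring_0"
  shows "(\<Sum>x<m1*m2. \<Sum>y<k1*k2. f (x div m2) (y div k2) * g (x mod m2) (y mod k2))
    = (\<Sum>x<m1. \<Sum>y<k1. f x y) * (\<Sum>x<m2. \<Sum>y<k2. g x y)"
  by (simp add: sum_lessThan_times mixed_radix_div_mod flip: sum_product)

lemma isometric_tensor:
  assumes 1: "isometric n1 dB1 dE1 K1" and 2: "isometric n2 dB2 dE2 K2"
  shows "isometric (n1 * n2) (dB1 * dB2) (dE1 * dE2) (kraus_tensor n2 dB2 dE2 K1 K2)"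
  unfolding isometric_def
proof (intro allI impI)
  fix a a' assume a: "a < n1 * n2" "a' < n1 * n2"
  then have n2: "0 < n2" by (cases n2) auto
  have "(\<Sum>x<dB1*dB2. \<Sum>y<dE1*dE2. kraus_tensor n2 dB2 dE2 K1 K2 x y a * cnj (kraus_tensor n2 dB2 dE2 K1 K2 x y a'))
    = (\<Sum>x<dB1*dB2. \<Sum>y<dE1*dE2.
        (K1 (x div dB2) (y div dE2) (a div n2) * cnj (K1 (x div dB2) (y div dE2) (a' div n2)))
      * (K2 (x mod dB2) (y mod dE2) (a mod n2) * cnj (K2 (x mod dB2) (y mod dE2) (a' mod n2))))"
    by (simp add: kraus_tensor_def mult_ac)
  also have "\<dots> = (if a div n2 = a' div n2 then 1 else 0) * (if a mod n2 = a' mod n2 then 1 else 0)"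
    unfolding sum_tensor[where f="\<lambda>x y. K1 x y (a div n2) * cnj (K1 x y (a' div n2))"
        and g="\<lambda>x y. K2 x y (a mod n2) * cnj (K2 x y (a' mod n2))"]
    using 1 2 a n2 by (simp add: isometric_def less_mult_imp_div_less)
  also have "\<dots> = (if a = a' then 1 else 0)"
  proof -
    have "a = a' \<longleftrightarrow> a div n2 = a' div n2 \<and> a mod n2 = a' mod n2" by (metis div_mult_mod_eq)
    then show ?thesis by auto
  qed
  finally show "(\<Sum>x<dB1*dB2. \<Sum>y<dE1*dE2. kraus_tensor n2 dB2 dE2 K1 K2 x y a
      * cnj (kraus_tensor n2 dB2 dE2 K1 K2 x y a')) = (if a = a' then 1 else 0)" .
qed

text \<open>\<open>kraus_tensor\<close> and \<open>iso_tensor\<close> agree in their digit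
  convention: the second factor carries the low digit in the input, the receiver and the environment
  separately. A valid index forces the dimensions of the second factor to be positive, so that the
  digits are in range.\<close>

lemma dilation_iso_tensor:
  assumes N1: "dilation N1 n1 dB1 dE1 K1" and N2: "dilation N2 n2 dB2 dE2 K2"
  shows "dilation (iso_tensor N1 N2) (n1 * n2) (dB1 * dB2) (dE1 * dE2) (kraus_tensor n2 dB2 dE2 K1 K2)"
proof -
  obtain V1 where V1: "V1 \<in> carrier_mat (dB1 * dE1) n1" and NV1: "N1 = (dB1, dE1, V1)"
    and K1: "\<And>b e a. b < dB1 \<Longrightarrow> e < dE1 \<Longrightarrow> a < n1 \<Longrightarrow> V1 $$ (b * dE1 + e, a) = K1 b e a"
    using N1 by (cases N1) (auto simp: dilation_def)
  obtain V2 where V2: "V2 \<in> carrier_mat (dB2 * dE2) n2" and NV2: "N2 = (dB2, dE2, V2)"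
    and K2: "\<And>b e a. b < dB2 \<Longrightarrow> e < dE2 \<Longrightarrow> a < n2 \<Longrightarrow> V2 $$ (b * dE2 + e, a) = K2 b e a"
    using N2 by (cases N2) (auto simp: dilation_def)
  have "snd (snd (iso_tensor N1 N2)) $$ (b * (dE1 * dE2) + e, a) = kraus_tensor n2 dB2 dE2 K1 K2 b e a"
    if "b < dB1 * dB2" "e < dE1 * dE2" "a < n1 * n2" for b e a
  proof -
    have "0 < dB2" "0 < dE2" "0 < n2" using that by (auto intro!: Nat.gr0I)
    then show ?thesis
      using that V1 V2 mixed_radix_less[OF that(1,2)] mixed_radix_div_mod[OF that(2), of b]
      by (simp add: NV1 NV2 iso_tensor_def Let_def K1 K2 less_mult_imp_div_less kraus_tensor_def)
  qed
  moreover have "isometric (n1 * n2) (dB1 * dB2) (dE1 * dE2) (kraus_tensor n2 dB2 dE2 K1 K2)"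
    using N1 N2 by (intro isometric_tensor) (auto simp: dilation_def)
  moreover have "fst (iso_tensor N1 N2) = dB1 * dB2" "fst (snd (iso_tensor N1 N2)) = dE1 * dE2"
    "snd (snd (iso_tensor N1 N2)) \<in> carrier_mat (dB1 * dB2 * (dE1 * dE2)) (n1 * n2)"
    using V1 V2 by (auto simp: NV1 NV2 iso_tensor_def)
  ultimately show ?thesis unfolding dilation_def by blast
qed

text \<open>At power 0 all three dimensions are 1, so the constant 1 represents the trivial
  isometry.\<close>

primrec kraus_pow ::
  "nat \<Rightarrow> nat \<Rightarrow> nat \<Rightarrow> (nat \<Rightarrow> nat \<Rightarrow> nat \<Rightarrow> complex) \<Rightarrow> nat \<Rightarrow> nat \<Rightarrow> nat \<Rightarrow> nat \<Rightarrow> complex" where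
  "kraus_pow n dB dE K 0 = (\<lambda>b e a. 1)"
| "kraus_pow n dB dE K (Suc m) = kraus_tensor n dB dE (kraus_pow n dB dE K m) K"

lemma dilation_tensor_pow:
  assumes "dilation N n dB dE K"
  shows "dilation (tensor_pow N m) (n ^ m) (dB ^ m) (dE ^ m) (kraus_pow n dB dE K m)"
proof (induction m)
  case 0
  show ?case by (auto simp: dilation_def isometric_def)
next
  case (Suc m)
  from dilation_iso_tensor[OF Suc assms] show ?case by (simp add: mult.commute)
qed

text \<open>A single application of Jensen's inequality to the weights
  \<open>p\<^sub>k |\<langle>b, v\<^sub>l| V |u\<^sub>k\<rangle>|\<^sup>2\<close>, where \<open>(p, u)\<close> and \<open>(q, v)\<close> diagonalize the input and the
  environment state. Their marginals are \<open>p\<close>, \<open>q\<close> and the diagonal of the output state.\<close>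

lemma mutual_information_le_log:
  assumes K: "isometric n dB dE K" and \<rho>: "density n \<rho>"
    and t: "\<And>b. b < dB \<Longrightarrow> 0 \<le> t b" and t1: "(\<Sum>b<dB. t b) \<le> 1" and C: "0 < C"
    and supp: "\<And>b. b < dB \<Longrightarrow> t b = 0 \<Longrightarrow> Re (cp_map n dB dE K \<rho> $$ (b, b)) = 0"
    and bound: "\<And>v. (\<Sum>e<dE. (cmod (v e))\<^sup>2) = 1 \<Longrightarrow>
      (\<Sum>b<dB. (\<Sum>a<n. (cmod (\<Sum>e<dE. cnj (v e) * K b e a))\<^sup>2) / t b) \<le> C"
  shows "vN_entropy \<rho> + (vN_entropy (cp_map n dB dE K \<rho>) - vN_entropy (cp_map n dE dB (\<lambda>e b. K b e) \<rho>)) \<le> log 2 C"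
proof -
  let ?B = "cp_map n dB dE K \<rho>" and ?E = "cp_map n dE dB (\<lambda>e b. K b e) \<rho>"
  have dB: "density dB ?B" by (rule density_cp_map[OF \<rho> K])
  have dE: "density dE ?E" by (rule density_cp_map[OF \<rho> isometric_swap[OF K]])
  obtain p u where E: "eigensystem n \<rho> p u" by (rule density_eigensystem[OF \<rho>])
  obtain q v where F: "eigensystem dE ?E q v" by (rule density_eigensystem[OF dE])
  note u = eigensystemD(1)[OF E] and p = eigensystemD(2)[OF E] and p1 = eigensystemD(3)[OF E]
  note v = eigensystemD(1)[OF F] and q = eigensystemD(2)[OF F]
  define g where "g l k b = (cmod (\<Sum>e<dE. cnj (v l e) * (\<Sum>a<n. K b e a * u k a)))\<^sup>2" for l k b
  have g0: "0 \<le> g l k b" for l k b by (simp add: g_def)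
  define w where "w l k b = p k * g l k b" for l k b
  have w0: "0 \<le> w l k b" if "k < n" for l k b using p[OF that] g0 by (simp add: w_def)
  have wq: "(\<Sum>k<n. \<Sum>b<dB. w l k b) = q l" if l: "l < dE" for l
  proof -
    have "complex_of_real (q l) = complex_of_real (\<Sum>b<dB. \<Sum>k<n. w l k b)"
      unfolding eigensystem_qform[OF F l, symmetric] cp_map_qform[OF E] w_def g_def by (rule refl)
    then have "q l = (\<Sum>b<dB. \<Sum>k<n. w l k b)" by (simp only: of_real_eq_iff)
    then show ?thesis by (simp add: sum.swap[of _ "{..<n}"])
  qed
  have wp: "(\<Sum>l<dE. \<Sum>b<dB. w l k b) = p k" if k: "k < n" for k
  proof -
    have "(\<Sum>l<dE. \<Sum>b<dB. g l k b) = (\<Sum>b<dB. \<Sum>l<dE. g l k b)" by (rule sum.swap)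
    also have "\<dots> = (\<Sum>b<dB. \<Sum>e<dE. (cmod (\<Sum>a<n. K b e a * u k a))\<^sup>2)"
      unfolding g_def by (simp add: onb_parseval(2)[OF v])
    also have "\<dots> = (\<Sum>be\<in>{..<dB} \<times> {..<dE}. (cmod (\<Sum>a<n. K (fst be) (snd be) a * u k a))\<^sup>2)"
      by (simp add: sum.cartesian_product')
    also have "\<dots> = (\<Sum>a<n. (cmod (u k a))\<^sup>2)"
      using K by (intro sum_swap_delta) (simp add: isometric_def sum.cartesian_product')
    also have "\<dots> = 1" by (rule onb_norm[OF u k])
    finally show ?thesis by (simp add: w_def flip: sum_distrib_left)
  qed
  have wB: "(\<Sum>l<dE. \<Sum>k<n. w l k b) = Re (?B $$ (b, b))" if b: "b < dB" for b
  proof -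
    have "(\<Sum>l<dE. \<Sum>k<n. w l k b) = (\<Sum>k<n. p k * (\<Sum>l<dE. g l k b))"
      by (subst sum.swap) (simp add: w_def sum_distrib_left)
    also have "\<dots> = (\<Sum>k<n. p k * (\<Sum>e<dE. (cmod (\<Sum>a<n. K b e a * u k a))\<^sup>2))"
      unfolding g_def by (simp add: onb_parseval(2)[OF v])
    also have "\<dots> = (\<Sum>e<dE. \<Sum>k<n. p k * (cmod (\<Sum>a<n. K b e a * u k a))\<^sup>2)"
      by (subst sum.swap) (simp add: sum_distrib_left)
    also have "complex_of_real \<dots> = qform dB ?B (\<lambda>x. if x = b then 1 else 0)"
      using b by (simp add: cp_map_qform[OF E] if_distrib[of cnj] if_distrib[of "\<lambda>x. x * _"] cong: if_cong)
    also have "\<dots> = ?B $$ (b, b)" by (rule qform_standard[OF b])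
    finally show ?thesis by (metis Re_complex_of_real)
  qed
  \<comment> \<open>Each marginal is at least any single weight contributing to it, so a positive
    weight makes all three marginals positive.\<close>
  have pos: "0 < p k" "0 < q l" "0 < t b" if "l < dE" "k < n" "b < dB" "0 < w l k b" for l k b
  proof -
    show "0 < p k" using that(4) p[OF that(2)] g0[of l k b] by (auto simp: w_def zero_less_mult_iff)
    have "0 < (\<Sum>b<dB. w l k b)" using that w0 by (intro sum_pos2[of _ b]) auto
    then have "0 < (\<Sum>k<n. \<Sum>b<dB. w l k b)"
      by (rule sum_pos2[OF finite_lessThan, of k, rotated]) (use that w0 in \<open>auto intro!: sum_nonneg\<close>)
    then show "0 < q l" by (simp add: wq that)
    have "0 < (\<Sum>k<n. w l k b)" using that w0 by (intro sum_pos2[of _ k]) auto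
    then have "0 < (\<Sum>l<dE. \<Sum>k<n. w l k b)"
      by (rule sum_pos2[OF finite_lessThan, of l, rotated]) (use that w0 in \<open>auto intro!: sum_nonneg\<close>)
    then have "0 < Re (?B $$ (b, b))" by (simp add: wB that)
    then show "0 < t b" using supp[OF that(3)] t[OF that(3)] by (cases "t b = 0") auto
  qed
  let ?X = "{..<dE} \<times> {..<n} \<times> {..<dB}"
  define W where "W x = w (fst x) (fst (snd x)) (snd (snd x))" for x
  \<comment> \<open>The mean of \<open>log 2 (r x)\<close> is the input entropy minus the
    environment entropy plus the cross entropy of the output with \<open>t\<close>.\<close>
  define r where "r x = q (fst x) / (p (fst (snd x)) * t (snd (snd x)))" for x
  have "(\<Sum>x\<in>?X. W x * log 2 (r x)) \<le> log 2 C"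
  proof (rule sum_weighted_log_le)
    show "(\<Sum>x\<in>?X. W x) = 1"
      using eigensystemD(3)[OF F] by (simp add: W_def sum.cartesian_product' wq)
    have "(\<Sum>x\<in>?X. W x * r x) \<le> (\<Sum>x\<in>?X. q (fst x) * (g (fst x) (fst (snd x)) (snd (snd x)) / t (snd (snd x))))"
    proof (rule sum_mono)
      fix x assume "x \<in> ?X"
      then show "W x * r x \<le> q (fst x) * (g (fst x) (fst (snd x)) (snd (snd x)) / t (snd (snd x)))"
        using p[of "fst (snd x)"] q[of "fst x"] t[of "snd (snd x)"] g0[of "fst x" "fst (snd x)" "snd (snd x)"]
        by (cases "p (fst (snd x)) = 0") (auto simp: W_def w_def r_def mult.commute)
    qed
    also have "\<dots> = (\<Sum>l<dE. q l * (\<Sum>b<dB. (\<Sum>k<n. g l k b) / t b))"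
      by (simp add: sum.cartesian_product' sum_distrib_left sum_divide_distrib sum.swap[of _ "{..<n}"])
    also have "\<dots> \<le> (\<Sum>l<dE. q l * C)"
    proof (intro sum_mono mult_left_mono)
      fix l assume "l \<in> {..<dE}"
      then have l: "l < dE" by simp
      show "0 \<le> q l" by (rule q[OF l])
      \<comment> \<open>Parseval in the eigenbasis \<open>u\<close> of the input replaces it by the
        standard basis; what remains depends on \<open>v l\<close> only, which is the form of
        \<open>bound\<close>.\<close>
      have "(\<Sum>k<n. g l k b) = (\<Sum>a<n. (cmod (\<Sum>e<dE. cnj (v l e) * K b e a))\<^sup>2)" for b
      proof -
        have "g l k b = (cmod (\<Sum>a<n. u k a * (\<Sum>e<dE. cnj (v l e) * K b e a)))\<^sup>2" for k
          unfolding g_def sum_distrib_left by (subst sum.swap) (simp add: mult_ac)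
        then show ?thesis by (simp add: onb_parseval(1)[OF u])
      qed
      then show "(\<Sum>b<dB. (\<Sum>k<n. g l k b) / t b) \<le> C"
        using bound[OF onb_norm[OF v l]] by simp
    qed
    also have "\<dots> = C" using eigensystemD(3)[OF F] by (simp flip: sum_distrib_right)
    finally show "(\<Sum>x\<in>?X. W x * r x) \<le> C" .
    fix x assume x: "x \<in> ?X"
    show "0 \<le> W x" using x w0 by (auto simp: W_def)
    assume "0 < W x"
    with x show "0 < r x"
      using pos[of "fst x" "fst (snd x)" "snd (snd x)"] by (auto simp: W_def r_def intro!: divide_pos_pos)
  qed (simp_all add: C)
  also have "(\<Sum>x\<in>?X. W x * log 2 (r x))
    = (\<Sum>x\<in>?X. W x * log 2 (q (fst x)) - W x * log 2 (p (fst (snd x))) - W x * log 2 (t (snd (snd x))))"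
  proof (rule sum.cong[OF refl])
    fix x assume x: "x \<in> ?X"
    show "W x * log 2 (r x) = W x * log 2 (q (fst x)) - W x * log 2 (p (fst (snd x))) - W x * log 2 (t (snd (snd x)))"
    proof (cases "W x = 0")
      case False
      then have "0 < W x" using x w0 by (auto simp: W_def less_le)
      then show ?thesis
        using x pos[of "fst x" "fst (snd x)" "snd (snd x)"]
        by (auto simp: W_def r_def log_divide log_mult algebra_simps)
    qed simp
  qed
  also have "\<dots> = (\<Sum>l<dE. (\<Sum>k<n. \<Sum>b<dB. w l k b) * log 2 (q l))
    - (\<Sum>k<n. (\<Sum>l<dE. \<Sum>b<dB. w l k b) * log 2 (p k)) - (\<Sum>b<dB. (\<Sum>l<dE. \<Sum>k<n. w l k b) * log 2 (t b))"
  proof -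
    have "(\<Sum>k<n. (\<Sum>l<dE. \<Sum>b<dB. w l k b) * log 2 (p k)) = (\<Sum>l<dE. \<Sum>k<n. \<Sum>b<dB. w l k b * log 2 (p k))"
      by (subst sum.swap) (simp add: sum_distrib_right)
    moreover have "(\<Sum>b<dB. (\<Sum>l<dE. \<Sum>k<n. w l k b) * log 2 (t b)) = (\<Sum>l<dE. \<Sum>b<dB. \<Sum>k<n. w l k b * log 2 (t b))"
      by (subst sum.swap) (simp add: sum_distrib_right)
    moreover have "\<dots> = (\<Sum>l<dE. \<Sum>k<n. \<Sum>b<dB. w l k b * log 2 (t b))"
      by (rule sum.cong[OF refl], rule sum.swap)
    ultimately show ?thesis
      by (simp add: sum.cartesian_product' sum_subtractf W_def sum_distrib_right)
  qed
  also have "\<dots> = vN_entropy \<rho> - vN_entropy ?E - (\<Sum>b<dB. Re (?B $$ (b, b)) * log 2 (t b))"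
    by (simp add: wq wp wB eigensystemD(5)[OF E] eigensystemD(5)[OF F] entropy_fun_def sum_negf)
  finally have "vN_entropy \<rho> - vN_entropy ?E - (\<Sum>b<dB. Re (?B $$ (b, b)) * log 2 (t b)) \<le> log 2 C" .
  moreover have "vN_entropy ?B \<le> - (\<Sum>b<dB. Re (?B $$ (b, b)) * log 2 (t b))"
    by (rule vN_entropy_le_diag_cross_entropy[OF dB t t1 supp])
  ultimately show ?thesis by linarith
qed

subsection \<open>Product distributions and diagonal states\<close>

definition diag_real :: "nat \<Rightarrow> (nat \<Rightarrow> real) \<Rightarrow> complex mat" where
  "diag_real n f = mat n n (\<lambda>(i, j). if i = j then complex_of_real (f i) else 0)"

definition distribution :: "nat \<Rightarrow> (nat \<Rightarrow> real) \<Rightarrow> bool" where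
  "distribution n f \<longleftrightarrow> (\<forall>i<n. 0 \<le> f i) \<and> (\<Sum>i<n. f i) = 1"

definition shannon :: "nat \<Rightarrow> (nat \<Rightarrow> real) \<Rightarrow> real" where
  "shannon n f = (\<Sum>i<n. entropy_fun (f i))"

definition tensor_fun :: "nat \<Rightarrow> (nat \<Rightarrow> real) \<Rightarrow> (nat \<Rightarrow> real) \<Rightarrow> nat \<Rightarrow> real" where
  "tensor_fun n f g i = f (i div n) * g (i mod n)"

primrec pow_fun :: "nat \<Rightarrow> (nat \<Rightarrow> real) \<Rightarrow> nat \<Rightarrow> nat \<Rightarrow> real" where
  "pow_fun n f 0 = (\<lambda>i. 1)"
| "pow_fun n f (Suc m) = tensor_fun n (pow_fun n f m) f"

text \<open>The product of \<open>f s\<^sub>1, \<dots>, f s\<^sub>m\<close> for the binary digits \<open>s\<^sub>1 \<dots> s\<^sub>m\<close> of \<open>s\<close>,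
  so that \<open>s < 2\<^sup>m\<close> enumerates the code words of length \<open>m\<close>.\<close>

primrec word_fun :: "nat \<Rightarrow> (nat \<Rightarrow> nat \<Rightarrow> real) \<Rightarrow> nat \<Rightarrow> nat \<Rightarrow> nat \<Rightarrow> real" where
  "word_fun n f 0 = (\<lambda>s i. 1)"
| "word_fun n f (Suc m) = (\<lambda>s. tensor_fun n (word_fun n f m (s div 2)) (f (s mod 2)))"

lemma sum_tensor_fun: "(\<Sum>i<m*n. tensor_fun n f g i) = (\<Sum>i<m. f i) * (\<Sum>i<n. g i)"
  by (simp add: tensor_fun_def sum_lessThan_times mixed_radix_div_mod sum_product)

lemma distribution_tensor_fun:
  assumes "distribution m f" "distribution n g"
  shows "distribution (m * n) (tensor_fun n f g)"
proof -
  have "0 \<le> tensor_fun n f g i" if "i < m * n" for i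
  proof -
    have "0 < n" using that by (auto intro!: Nat.gr0I)
    then show ?thesis using that assms by (simp add: tensor_fun_def distribution_def less_mult_imp_div_less)
  qed
  then show ?thesis using assms by (simp add: distribution_def sum_tensor_fun)
qed

lemma entropy_fun_mult:
  assumes "0 \<le> x" "0 \<le> y"
  shows "entropy_fun (x * y) = x * entropy_fun y + y * entropy_fun x"
  using assms by (cases "x = 0"; cases "y = 0") (auto simp: entropy_fun_def log_mult algebra_simps)

lemma shannon_tensor_fun:
  assumes "distribution m f" "distribution n g"
  shows "shannon (m * n) (tensor_fun n f g) = shannon m f + shannon n g"
proof -
  have "shannon (m * n) (tensor_fun n f g) = (\<Sum>i<m. \<Sum>j<n. f i * entropy_fun (g j) + g j * entropy_fun (f i))"
    using assms by (simp add: shannon_def tensor_fun_def sum_lessThan_times mixed_radix_div_mod distribution_def entropy_fun_mult)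
  also have "\<dots> = (\<Sum>i<m. f i) * shannon n g + (\<Sum>j<n. g j) * shannon m f"
    by (simp add: sum.distrib shannon_def sum_product sum.swap[of "\<lambda>i j. g j * entropy_fun (f i)"])
  finally show ?thesis using assms by (simp add: distribution_def)
qed

lemma distribution_pow_fun: "distribution n f \<Longrightarrow> distribution (n ^ m) (pow_fun n f m)"
proof (induction m)
  case (Suc m)
  then show ?case using distribution_tensor_fun[of "n ^ m" "pow_fun n f m" n f] by (simp add: mult.commute)
qed (simp add: distribution_def)

lemma shannon_pow_fun: "distribution n f \<Longrightarrow> shannon (n ^ m) (pow_fun n f m) = real m * shannon n f"
proof (induction m)
  case (Suc m)
  then show ?case
    using shannon_tensor_fun[OF distribution_pow_fun[OF Suc.prems, of m] Suc.prems]
    by (simp add: mult.commute algebra_simps)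
qed (simp add: shannon_def entropy_fun_def)

lemma distribution_word_fun:
  assumes "\<And>s. s < 2 \<Longrightarrow> distribution n (f s)"
  shows "distribution (n ^ m) (word_fun n f m s)"
proof (induction m arbitrary: s)
  case (Suc m)
  then show ?case
    using distribution_tensor_fun[of "n ^ m" "word_fun n f m (s div 2)" n "f (s mod 2)"] assms[of "s mod 2"]
    by (simp add: mult.commute)
qed (simp add: distribution_def)

lemma sum_shannon_word_fun:
  assumes f: "\<And>s. s < 2 \<Longrightarrow> distribution n (f s)"
  shows "(\<Sum>s<2^m. shannon (n ^ m) (word_fun n f m s)) = 2 ^ m * (real m * ((shannon n (f 0) + shannon n (f 1)) / 2))"
proof (induction m)
  case (Suc m)
  have "(\<Sum>s<2^Suc m. shannon (n ^ Suc m) (word_fun n f (Suc m) s))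
    = (\<Sum>s<2^m*2. shannon (n ^ m * n) (tensor_fun n (word_fun n f m (s div 2)) (f (s mod 2))))"
    by (simp add: mult.commute)
  also have "\<dots> = (\<Sum>s<2^m. \<Sum>j<2. shannon (n ^ m * n) (tensor_fun n (word_fun n f m s) (f j)))"
    by (simp add: sum_lessThan_times mixed_radix_div_mod)
  also have "\<dots> = (\<Sum>s<2^m. \<Sum>j<2. shannon (n ^ m) (word_fun n f m s) + shannon n (f j))"
    using f distribution_word_fun[of n f] by (intro sum.cong refl shannon_tensor_fun) auto
  also have "\<dots> = 2 * (\<Sum>s<2^m. shannon (n ^ m) (word_fun n f m s)) + 2 ^ m * (shannon n (f 0) + shannon n (f 1))"
    by (simp add: sum.distrib numeral_2_eq_2 algebra_simps sum_distrib_left)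
  finally show ?case unfolding Suc.IH by (simp add: field_simps)
qed (simp add: shannon_def entropy_fun_def)

text \<open>Expanding the product of \<open>f 0 + f 1\<close> over all positions lists every word
  once. Hence the uniform mixture of the words is the product power of the mean letter.\<close>

lemma sum_word_fun: "(\<Sum>s<2^m. word_fun n f m s i) = 2 ^ m * pow_fun n (\<lambda>j. (f 0 j + f 1 j) / 2) m i"
proof (induction m arbitrary: i)
  case (Suc m)
  have "(\<Sum>s<2^Suc m. word_fun n f (Suc m) s i)
    = (\<Sum>s<2^m*2. word_fun n f m (s div 2) (i div n) * f (s mod 2) (i mod n))"
    by (simp add: mult.commute[of 2] tensor_fun_def)
  also have "\<dots> = (\<Sum>s<2^m. \<Sum>j<2. word_fun n f m s (i div n) * f j (i mod n))"
    by (simp add: sum_lessThan_times mixed_radix_div_mod)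
  also have "\<dots> = (\<Sum>s<2^m. word_fun n f m s (i div n)) * (f 0 (i mod n) + f 1 (i mod n))"
    by (simp add: sum_distrib_right numeral_2_eq_2 distrib_left)
  finally show ?case unfolding Suc.IH by (simp add: tensor_fun_def)
qed simp

section \<open>Diagonal states and their images under channels\<close>

lemma density_diag_real:
  assumes "distribution n f"
  shows "density n (diag_real n f)"
proof -
  have q: "qform n (diag_real n f) v = complex_of_real (\<Sum>i<n. f i * (cmod (v i))\<^sup>2)" for v
  proof -
    have "qform n (diag_real n f) v = (\<Sum>i<n. \<Sum>j<n. if i = j then complex_of_real (f i) * (v i * cnj (v i)) else 0)"
      unfolding qform_def by (intro sum.cong refl) (auto simp: diag_real_def)
    then show ?thesis by (simp add: of_real_cmod_sq del: of_real_power)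
  qed
  have "0 \<le> Re (qform n (diag_real n f) v)" for v
    unfolding q using assms by (auto simp: distribution_def intro!: sum_nonneg)
  moreover have "(\<Sum>i<n. diag_real n f $$ (i, i)) = 1"
    using assms by (simp add: diag_real_def distribution_def flip: of_real_sum)
  moreover have "\<forall>i<n. \<forall>j<n. diag_real n f $$ (i, j) = cnj (diag_real n f $$ (j, i))"
    by (auto simp: diag_real_def)
  moreover have "diag_real n f \<in> carrier_mat n n" by (simp add: diag_real_def)
  ultimately show ?thesis unfolding density_iff_qform by blast
qed

lemma vN_entropy_diag_real: "vN_entropy (diag_real n f) = shannon n f"
proof -
  have "diag_real n f \<in> carrier_mat n n" "upper_triangular (diag_real n f)"
    by (auto simp: diag_real_def upper_triangular_def)
  moreover from this have "similar_mat (diag_real n f) (diag_real n f)" by (intro similar_mat_refl)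
  ultimately have "vN_entropy (diag_real n f) = (\<Sum>k<n. entropy_fun (Re (diag_real n f $$ (k, k))))"
    by (intro vN_entropy_upper_triangular)
  then show ?thesis by (simp add: shannon_def diag_real_def)
qed

text \<open>Expresses that \<open>cp_map\<close> sends \<open>diag_real n f\<close> to
  \<open>diag_real dX g\<close>, as an identity between amplitudes that factorises under
  \<open>kraus_tensor\<close>.\<close>

definition diag_maps ::
  "nat \<Rightarrow> nat \<Rightarrow> nat \<Rightarrow> (nat \<Rightarrow> nat \<Rightarrow> nat \<Rightarrow> complex) \<Rightarrow> (nat \<Rightarrow> real) \<Rightarrow> (nat \<Rightarrow> real) \<Rightarrow> bool" where
  "diag_maps n dX dY K f g \<longleftrightarrow> (\<forall>x<dX. \<forall>x'<dX.
     (\<Sum>y<dY. \<Sum>a<n. complex_of_real (f a) * (K x y a * cnj (K x' y a))) = (if x = x' then complex_of_real (g x) else 0))"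

lemma cp_map_diag_real:
  assumes "diag_maps n dX dY K f g"
  shows "cp_map n dX dY K (diag_real n f) = diag_real dX g"
proof (rule eq_matI)
  fix x x' assume "x < dim_row (diag_real dX g)" "x' < dim_col (diag_real dX g)"
  then have x: "x < dX" "x' < dX" by (auto simp: diag_real_def)
  have "cp_map n dX dY K (diag_real n f) $$ (x, x') = (\<Sum>y<dY. \<Sum>a<n. complex_of_real (f a) * (K x y a * cnj (K x' y a)))"
    using x by (simp add: cp_map_def diag_real_def if_distrib[of "\<lambda>z. z * _"] if_distrib[of "\<lambda>z. _ * z"] mult_ac cong: if_cong)
  then show "cp_map n dX dY K (diag_real n f) $$ (x, x') = diag_real dX g $$ (x, x')"
    using assms x by (simp add: diag_maps_def diag_real_def)
qed (auto simp: cp_map_def diag_real_def)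

lemma diag_maps_tensor:
  assumes 1: "diag_maps n1 dX1 dY1 K1 f1 g1" and 2: "diag_maps n2 dX2 dY2 K2 f2 g2"
  shows "diag_maps (n1 * n2) (dX1 * dX2) (dY1 * dY2) (kraus_tensor n2 dX2 dY2 K1 K2)
    (tensor_fun n2 f1 f2) (tensor_fun dX2 g1 g2)"
  unfolding diag_maps_def
proof (intro allI impI)
  fix x x' assume x: "x < dX1 * dX2" "x' < dX1 * dX2"
  then have d: "0 < dX2" by (auto intro!: Nat.gr0I)
  have "(\<Sum>y<dY1*dY2. \<Sum>a<n1*n2. complex_of_real (tensor_fun n2 f1 f2 a)
      * (kraus_tensor n2 dX2 dY2 K1 K2 x y a * cnj (kraus_tensor n2 dX2 dY2 K1 K2 x' y a)))
    = (\<Sum>y<dY1*dY2. \<Sum>a<n1*n2.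
        (complex_of_real (f1 (a div n2)) * (K1 (x div dX2) (y div dY2) (a div n2) * cnj (K1 (x' div dX2) (y div dY2) (a div n2))))
      * (complex_of_real (f2 (a mod n2)) * (K2 (x mod dX2) (y mod dY2) (a mod n2) * cnj (K2 (x' mod dX2) (y mod dY2) (a mod n2)))))"
    by (simp add: kraus_tensor_def tensor_fun_def mult_ac)
  also have "\<dots> = (if x div dX2 = x' div dX2 then complex_of_real (g1 (x div dX2)) else 0)
      * (if x mod dX2 = x' mod dX2 then complex_of_real (g2 (x mod dX2)) else 0)"
    unfolding sum_tensor[where f="\<lambda>y a. complex_of_real (f1 a) * (K1 (x div dX2) y a * cnj (K1 (x' div dX2) y a))"
        and g="\<lambda>y a. complex_of_real (f2 a) * (K2 (x mod dX2) y a * cnj (K2 (x' mod dX2) y a))"]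
    using 1 2 x d by (simp add: diag_maps_def less_mult_imp_div_less)
  also have "\<dots> = (if x = x' then complex_of_real (tensor_fun dX2 g1 g2 x) else 0)"
  proof -
    have "x = x' \<longleftrightarrow> x div dX2 = x' div dX2 \<and> x mod dX2 = x' mod dX2" by (metis div_mult_mod_eq)
    then show ?thesis by (auto simp: tensor_fun_def)
  qed
  finally show "(\<Sum>y<dY1*dY2. \<Sum>a<n1*n2. complex_of_real (tensor_fun n2 f1 f2 a)
      * (kraus_tensor n2 dX2 dY2 K1 K2 x y a * cnj (kraus_tensor n2 dX2 dY2 K1 K2 x' y a)))
    = (if x = x' then complex_of_real (tensor_fun dX2 g1 g2 x) else 0)" .
qed

lemma diag_maps_word_fun:
  assumes "\<And>s. s < 2 \<Longrightarrow> diag_maps n dX dY K (f s) (g s)"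
  shows "diag_maps (n ^ m) (dX ^ m) (dY ^ m) (kraus_pow n dX dY K m) (word_fun n f m s) (word_fun dX g m s)"
proof (induction m arbitrary: s)
  case (Suc m)
  from diag_maps_tensor[OF Suc.IH[of "s div 2"] assms[of "s mod 2"]] show ?case
    by (simp add: mult.commute)
qed (simp add: diag_maps_def)

text \<open>The complement of a tensor power is the tensor power of the complement, so environment
  outputs of code words can be computed letter by letter.\<close>

lemma kraus_pow_swap: "(\<lambda>e b. kraus_pow n dB dE K m b e) = kraus_pow n dE dB (\<lambda>e b. K b e) m"
proof (induction m)
  case (Suc m)
  then have IH: "kraus_pow n dB dE K m b e a = kraus_pow n dE dB (\<lambda>e b. K b e) m e b a" for b e a
    by (rule fun_cong[THEN fun_cong[THEN fun_cong]])
  show ?case by (intro ext) (simp add: kraus_tensor_def IH)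
qed simp

subsection \<open>The platypus channel\<close>

definition platypus_kraus :: "nat \<Rightarrow> (nat \<Rightarrow> real) \<Rightarrow> nat \<Rightarrow> nat \<Rightarrow> nat \<Rightarrow> complex" where
  "platypus_kraus d \<mu> b e a =
     (if a = 0 then (if b = e \<and> b < d then complex_of_real (sqrt (\<mu> b)) else 0)
      else (if b = d \<and> e = a - 1 then 1 else 0))"

lemma platypus_kraus_simps:
  "b < d \<Longrightarrow> platypus_kraus d \<mu> b e 0 = (if b = e then complex_of_real (sqrt (\<mu> b)) else 0)"
  "platypus_kraus d \<mu> d e 0 = 0"
  "b < d \<Longrightarrow> platypus_kraus d \<mu> b e (Suc i) = 0"
  "platypus_kraus d \<mu> d e (Suc i) = (if e = i then 1 else 0)"
  by (auto simp: platypus_kraus_def)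

text \<open>Input 0 reaches only the pairs \<open>(j, j)\<close> with \<open>j < d\<close>, and
  input \<open>a > 0\<close> only the pair \<open>(d, a - 1)\<close>.\<close>

lemma platypus_kraus_sum:
  assumes "a < Suc d"
  shows "(\<Sum>b<Suc d. \<Sum>e<d. platypus_kraus d \<mu> b e a * f b e)
    = (if a = 0 then \<Sum>j<d. complex_of_real (sqrt (\<mu> j)) * f j j else f d (a - 1))"
proof (cases a)
  case 0
  then show ?thesis
    by (simp add: platypus_kraus_simps if_distrib[of "\<lambda>z. z * _"] cong: if_cong)
next
  case (Suc i)
  then show ?thesis using assms
    by (simp add: platypus_kraus_simps if_distrib[of "\<lambda>z. z * _"] cong: if_cong)
qed

text \<open>Twice the optimal output state \<open>diag (\<mu>/2, 1/2)\<close>.\<close>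

definition platypus_weight :: "nat \<Rightarrow> (nat \<Rightarrow> real) \<Rightarrow> nat \<Rightarrow> real" where
  "platypus_weight d \<mu> b = (if b < d then \<mu> b else 1)"

text \<open>Cut \<open>x\<close> and \<open>y\<close> into slices \<open>X b2\<close> and
  \<open>Y e2\<close> along the added factor; \<open>F\<close> is the bilinear expression of the
  first factor. Added input 0 combines the terms \<open>F (X j) (Y j)\<close> with coefficients
  \<open>sqrt (\<mu> j)\<close>, while input \<open>i + 1\<close> gives \<open>F (X d) (Y i)\<close>
  alone. The squared moduli for different added inputs add up, and both parts share the factor
  \<open>\<Sum>j<d. M (Y j)\<close>, the squared norm of \<open>y\<close>; their other factors sum
  to the weighted norm of \<open>x\<close>. As the slices are arbitrary, correlations between the
  factors do no harm.\<close>

lemma bilinear_bounded_platypus_tensor: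
  assumes b: "bilinear_bounded n1 dB1 dE1 K1 t1" and \<mu>: "\<And>j. j < d \<Longrightarrow> 0 \<le> \<mu> j"
  shows "bilinear_bounded (n1 * Suc d) (dB1 * Suc d) (dE1 * d) (kraus_tensor (Suc d) (Suc d) d K1 (platypus_kraus d \<mu>))
    (tensor_fun (Suc d) t1 (platypus_weight d \<mu>))"
  unfolding bilinear_bounded_def
proof (intro conjI allI impI)
  have t1: "0 \<le> t1 i" if "i < dB1" for i using b that by (simp add: bilinear_bounded_def)
  show "0 \<le> tensor_fun (Suc d) t1 (platypus_weight d \<mu>) i" if "i < dB1 * Suc d" for i
    using that t1[of "i div Suc d"] \<mu> by (simp add: tensor_fun_def platypus_weight_def less_mult_imp_div_less)
  fix x y :: "nat \<Rightarrow> complex"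
  define X where "X b2 b1 = x (b1 * Suc d + b2)" for b2 b1
  define Y where "Y e2 e1 = y (e1 * d + e2)" for e2 e1
  define F where "F x y a = (\<Sum>b<dB1. \<Sum>e<dE1. x b * y e * K1 b e a)" for x y a
  define T where "T x = (\<Sum>b<dB1. t1 b * (cmod (x b))\<^sup>2)" for x
  define M where "M y = (\<Sum>e<dE1. (cmod (y e))\<^sup>2)" for y
  have FTM: "(\<Sum>a<n1. (cmod (F x y a))\<^sup>2) \<le> T x * M y" for x y
    using b unfolding bilinear_bounded_def F_def T_def M_def by blast
  have T0: "0 \<le> T x" for x using t1 by (auto simp: T_def intro!: sum_nonneg)
  have M0: "0 \<le> M y" for y by (auto simp: M_def intro!: sum_nonneg)
  \<comment> \<open>Makes the later division by \<open>M (Y j)\<close> safe when a slice of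
    \<open>y\<close> is zero.\<close>
  have F0: "F x y a = 0" if "M y = 0" "a < n1" for x y a
  proof -
    have "(cmod (F x y a))\<^sup>2 \<le> (\<Sum>a<n1. (cmod (F x y a))\<^sup>2)"
      using that by (intro member_le_sum) auto
    also have "\<dots> \<le> 0" using FTM[of x y] that by simp
    finally show ?thesis by simp
  qed
  define G where "G a1 a2 = (\<Sum>b2<Suc d. \<Sum>e2<d. platypus_kraus d \<mu> b2 e2 a2 * F (X b2) (Y e2) a1)" for a1 a2
  have "(\<Sum>a<n1 * Suc d. (cmod (\<Sum>b<dB1 * Suc d. \<Sum>e<dE1 * d. x b * y e
      * kraus_tensor (Suc d) (Suc d) d K1 (platypus_kraus d \<mu>) b e a))\<^sup>2)
    = (\<Sum>a1<n1. \<Sum>a2<Suc d. (cmod (G a1 a2))\<^sup>2)"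
  proof -
    have G: "(\<Sum>b1<dB1. \<Sum>b2<Suc d. \<Sum>e1<dE1. \<Sum>e2<d. X b2 b1 * Y e2 e1 * (K1 b1 e1 a1 * platypus_kraus d \<mu> b2 e2 a2)) = G a1 a2"
      for a1 a2
    proof -
      have "(\<Sum>b1<dB1. \<Sum>b2<Suc d. \<Sum>e1<dE1. \<Sum>e2<d. X b2 b1 * Y e2 e1 * (K1 b1 e1 a1 * platypus_kraus d \<mu> b2 e2 a2))
        = (\<Sum>b2<Suc d. \<Sum>b1<dB1. \<Sum>e2<d. \<Sum>e1<dE1. X b2 b1 * Y e2 e1 * (K1 b1 e1 a1 * platypus_kraus d \<mu> b2 e2 a2))"
        by (subst sum.swap, rule sum.cong[OF refl], rule sum.cong[OF refl], rule sum.swap)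
      also have "\<dots> = (\<Sum>b2<Suc d. \<Sum>e2<d. \<Sum>b1<dB1. \<Sum>e1<dE1. X b2 b1 * Y e2 e1 * (K1 b1 e1 a1 * platypus_kraus d \<mu> b2 e2 a2))"
        by (rule sum.cong[OF refl], rule sum.swap)
      also have "\<dots> = G a1 a2"
        unfolding G_def F_def by (simp only: sum_distrib_left mult_ac)
      finally show ?thesis .
    qed
    have r: "x (b1 * Suc d + b2) = X b2 b1" "y (e1 * d + e2) = Y e2 e1" for b1 b2 e1 e2
      by (simp_all add: X_def Y_def)
    show ?thesis
      unfolding sum_lessThan_times r kraus_tensor_def
      by (intro sum.cong refl arg_cong[where f="\<lambda>z. (cmod z)\<^sup>2"], subst G[symmetric], intro sum.cong refl)
         (simp only: lessThan_iff mixed_radix_div_mod)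
  qed
  also have "\<dots> = (\<Sum>a1<n1. (cmod (G a1 0))\<^sup>2) + (\<Sum>a1<n1. \<Sum>i<d. (cmod (G a1 (Suc i)))\<^sup>2)"
    by (simp only: sum.lessThan_Suc_shift sum.distrib)
  also have "(\<Sum>a1<n1. (cmod (G a1 0))\<^sup>2) \<le> (\<Sum>j<d. M (Y j)) * (\<Sum>j<d. \<mu> j * T (X j))"
  proof -
    have "(cmod (G a 0))\<^sup>2 \<le> (\<Sum>j<d. M (Y j)) * (\<Sum>j<d. \<mu> j * ((cmod (F (X j) (Y j) a))\<^sup>2 / M (Y j)))" if a: "a < n1" for a
    proof -
      \<comment> \<open>Cauchy-Schwarz is weighted by the norms of the slices \<open>Y j\<close>:
        one factor becomes the norm of \<open>y\<close>, and in the other the quotients, summed over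
        \<open>a\<close>, are at most \<open>T (X j)\<close> by \<open>FTM\<close>.\<close>
      let ?c = "\<lambda>j. complex_of_real (sqrt (M (Y j)))"
      have "G a 0 = (\<Sum>j<d. complex_of_real (sqrt (\<mu> j)) * F (X j) (Y j) a)"
        unfolding G_def by (subst platypus_kraus_sum) auto
      also have "\<dots> = (\<Sum>j<d. ?c j * (complex_of_real (sqrt (\<mu> j)) * F (X j) (Y j) a / ?c j))"
        using F0[OF _ a] by (intro sum.cong refl) auto
      finally have "(cmod (G a 0))\<^sup>2 \<le> (\<Sum>j<d. (cmod (?c j))\<^sup>2)
          * (\<Sum>j<d. (cmod (complex_of_real (sqrt (\<mu> j)) * F (X j) (Y j) a / ?c j))\<^sup>2)"
        by (simp only: cmod_sum_mult_le)
      also have "\<dots> = (\<Sum>j<d. M (Y j)) * (\<Sum>j<d. \<mu> j * ((cmod (F (X j) (Y j) a))\<^sup>2 / M (Y j)))"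
        using M0 \<mu> by (simp add: norm_mult norm_divide power_mult_distrib power_divide)
      finally show ?thesis .
    qed
    then have "(\<Sum>a<n1. (cmod (G a 0))\<^sup>2)
        \<le> (\<Sum>a<n1. (\<Sum>j<d. M (Y j)) * (\<Sum>j<d. \<mu> j * ((cmod (F (X j) (Y j) a))\<^sup>2 / M (Y j))))"
      by (intro sum_mono) auto
    also have "\<dots> = (\<Sum>j<d. M (Y j)) * (\<Sum>j<d. \<mu> j * ((\<Sum>a<n1. (cmod (F (X j) (Y j) a))\<^sup>2) / M (Y j)))"
      by (simp add: sum_divide_distrib sum_distrib_left[of "\<mu> j" for j] sum.swap[of _ "{..<d}" "{..<n1}"] flip: sum_distrib_left[of "sum _ _"])
    also have "\<dots> \<le> (\<Sum>j<d. M (Y j)) * (\<Sum>j<d. \<mu> j * T (X j))"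
    proof (intro mult_left_mono sum_mono)
      fix j assume "j \<in> {..<d}"
      show "(\<Sum>a<n1. (cmod (F (X j) (Y j) a))\<^sup>2) / M (Y j) \<le> T (X j)"
        using FTM[of "X j" "Y j"] M0[of "Y j"] T0[of "X j"]
        by (cases "M (Y j) = 0") (auto simp: divide_le_eq)
    qed (use \<mu> M0 in \<open>auto intro!: sum_nonneg\<close>)
    finally show ?thesis .
  qed
  also have "(\<Sum>a1<n1. \<Sum>i<d. (cmod (G a1 (Suc i)))\<^sup>2) \<le> (\<Sum>j<d. M (Y j)) * T (X d)"
  proof -
    have "(\<Sum>a1<n1. \<Sum>i<d. (cmod (G a1 (Suc i)))\<^sup>2) = (\<Sum>i<d. \<Sum>a1<n1. (cmod (F (X d) (Y i) a1))\<^sup>2)"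
      unfolding G_def by (subst sum.swap) (simp add: platypus_kraus_sum del: sum.lessThan_Suc)
    also have "\<dots> \<le> (\<Sum>i<d. T (X d) * M (Y i))" by (intro sum_mono FTM)
    finally show ?thesis by (simp add: sum_distrib_left mult.commute)
  qed
  also have "(\<Sum>j<d. M (Y j)) * (\<Sum>j<d. \<mu> j * T (X j)) + (\<Sum>j<d. M (Y j)) * T (X d)
    = (\<Sum>b<dB1 * Suc d. tensor_fun (Suc d) t1 (platypus_weight d \<mu>) b * (cmod (x b))\<^sup>2) * (\<Sum>e<dE1 * d. (cmod (y e))\<^sup>2)"
  proof -
    have "(\<Sum>e<dE1 * d. (cmod (y e))\<^sup>2) = (\<Sum>j<d. M (Y j))"
      unfolding sum_lessThan_times M_def Y_def by (rule sum.swap)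
    moreover have "(\<Sum>b<dB1 * Suc d. tensor_fun (Suc d) t1 (platypus_weight d \<mu>) b * (cmod (x b))\<^sup>2)
      = (\<Sum>b2<Suc d. platypus_weight d \<mu> b2 * T (X b2))"
    proof -
      have "(\<Sum>b<dB1 * Suc d. tensor_fun (Suc d) t1 (platypus_weight d \<mu>) b * (cmod (x b))\<^sup>2)
        = (\<Sum>b1<dB1. \<Sum>b2<Suc d. platypus_weight d \<mu> b2 * (t1 b1 * (cmod (X b2 b1))\<^sup>2))"
        unfolding sum_lessThan_times tensor_fun_def X_def
        by (intro sum.cong refl) (simp only: lessThan_iff mixed_radix_div_mod, simp add: mult_ac)
      also have "\<dots> = (\<Sum>b2<Suc d. platypus_weight d \<mu> b2 * T (X b2))"
        by (subst sum.swap) (simp only: T_def sum_distrib_left)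
      finally show ?thesis .
    qed
    ultimately show ?thesis by (simp add: platypus_weight_def algebra_simps)
  qed
  finally show "(\<Sum>a<n1 * Suc d. (cmod (\<Sum>b<dB1 * Suc d. \<Sum>e<dE1 * d. x b * y e
      * kraus_tensor (Suc d) (Suc d) d K1 (platypus_kraus d \<mu>) b e a))\<^sup>2)
    \<le> (\<Sum>b<dB1 * Suc d. tensor_fun (Suc d) t1 (platypus_weight d \<mu>) b * (cmod (x b))\<^sup>2) * (\<Sum>e<dE1 * d. (cmod (y e))\<^sup>2)"
    by simp
qed

lemma bilinear_bounded_platypus_pow:
  assumes "\<And>j. j < d \<Longrightarrow> 0 \<le> \<mu> j"
  shows "bilinear_bounded (Suc d ^ m) (Suc d ^ m) (d ^ m) (kraus_pow (Suc d) (Suc d) d (platypus_kraus d \<mu>) m)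
    (pow_fun (Suc d) (platypus_weight d \<mu>) m)"
proof (induction m)
  case 0
  show ?case by (simp add: bilinear_bounded_def norm_mult power_mult_distrib)
next
  case (Suc m)
  from bilinear_bounded_platypus_tensor[OF Suc, of d \<mu>] assms
  show ?case by (simp add: mult.commute[of "_ ^ m"] power_Suc del: mult_Suc mult_Suc_right)
qed

lemma entropy_fun_half: "entropy_fun (1 / 2) = 1 / 2"
  by (simp add: entropy_fun_def log_divide)

section \<open>Tensor powers of a fixed platypus channel: dilations and the Holevo bound\<close>

context
  fixes d :: nat and \<mu> :: "nat \<Rightarrow> real"
  assumes \<mu>: "distribution d \<mu>"
begin

lemma \<mu>_nonneg: "j < d \<Longrightarrow> 0 \<le> \<mu> j"
  using \<mu> by (simp add: distribution_def)

lemma \<mu>_sum: "(\<Sum>j<d. \<mu> j) = 1"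
  using \<mu> by (simp add: distribution_def)

lemma isometric_platypus: "isometric (Suc d) (Suc d) d (platypus_kraus d \<mu>)"
  unfolding isometric_def
proof (intro allI impI)
  fix a a' assume a: "a < Suc d" "a' < Suc d"
  have "(\<Sum>j<d. complex_of_real (sqrt (\<mu> j)) * complex_of_real (sqrt (\<mu> j))) = (\<Sum>j<d. complex_of_real (\<mu> j))"
    using \<mu>_nonneg by (intro sum.cong refl) (simp flip: of_real_mult)
  also have "\<dots> = 1" using \<mu>_sum by (simp flip: of_real_sum)
  finally have "(\<Sum>j<d. complex_of_real (sqrt (\<mu> j)) * complex_of_real (sqrt (\<mu> j))) = 1" .
  then show "(\<Sum>x<Suc d. \<Sum>y<d. platypus_kraus d \<mu> x y a * cnj (platypus_kraus d \<mu> x y a')) = (if a = a' then 1 else 0)"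
    unfolding platypus_kraus_sum[OF a(1)] using a
    by (cases a; cases a') (auto simp: platypus_kraus_simps)
qed

lemma dilation_platypus: "dilation (platypus d \<mu>) (Suc d) (Suc d) d (platypus_kraus d \<mu>)"
proof -
  have "platypus_iso d \<mu> $$ (b * d + e, a) = platypus_kraus d \<mu> b e a" if "b < Suc d" "e < d" "a < Suc d" for b e a
    using that mixed_radix_less[OF that(1,2)] mixed_radix_div_mod[OF that(2), of b]
    by (simp add: platypus_iso_def platypus_kraus_def Let_def)
  then show ?thesis
    using isometric_platypus by (simp add: dilation_def platypus_def) (simp add: platypus_iso_def)
qed

lemma dilation_platypus_pow:
  "dilation (tensor_pow (platypus d \<mu>) m) (Suc d ^ m) (Suc d ^ m) (d ^ m) (kraus_pow (Suc d) (Suc d) d (platypus_kraus d \<mu>) m)"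
  by (rule dilation_tensor_pow[OF dilation_platypus])

text \<open>Each factor contributes 2, the mass 1 of \<mu> plus the weight 1 of level
  \<open>d\<close>. Its logarithm is the Holevo bound \<open>m\<close>.\<close>

lemma sum_pow_weight: "(\<Sum>i<Suc d ^ m. pow_fun (Suc d) (platypus_weight d \<mu>) m i) = 2 ^ m"
proof (induction m)
  case (Suc m)
  have "(\<Sum>i<Suc d. platypus_weight d \<mu> i) = 2" using \<mu>_sum by (simp add: platypus_weight_def)
  then show ?case
    using sum_tensor_fun[where m="Suc d ^ m" and n="Suc d" and f="pow_fun (Suc d) (platypus_weight d \<mu>) m" and g="platypus_weight d \<mu>"] Suc
    by (simp add: mult.commute[of "_ ^ m"] del: mult_Suc mult_Suc_right)
qed simp

lemma holevo_ens_platypus_pow_le: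
  assumes "ensemble (Suc d ^ m) k p \<rho>"
  shows "holevo_ens (tensor_pow (platypus d \<mu>) m) k p \<rho> \<le> real m"
proof -
  have "holevo_ens (tensor_pow (platypus d \<mu>) m) k p \<rho> \<le> log 2 (2 ^ m)"
    by (rule holevo_ens_le_of_bilinear_bounded[OF dilation_platypus_pow bilinear_bounded_platypus_pow _ _ assms])
       (auto simp: \<mu>_nonneg sum_pow_weight)
  then show ?thesis by (simp add: log_nat_power)
qed

lemma diag_maps_platypus:
  "diag_maps (Suc d) (Suc d) d (platypus_kraus d \<mu>) f (\<lambda>b. if b < d then \<mu> b * f 0 else \<Sum>i<d. f (Suc i))"
  unfolding diag_maps_def
proof (intro allI impI)
  fix x x' assume x: "x < Suc d" "x' < Suc d"
  show "(\<Sum>y<d. \<Sum>a<Suc d. complex_of_real (f a) * (platypus_kraus d \<mu> x y a * cnj (platypus_kraus d \<mu> x' y a)))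
    = (if x = x' then complex_of_real (if x < d then \<mu> x * f 0 else \<Sum>i<d. f (Suc i)) else 0)"
    using x \<mu>_nonneg
    by (cases "x = d"; cases "x' = d")
       (auto simp: sum.lessThan_Suc_shift platypus_kraus_simps if_distrib[of "\<lambda>z. z * _"] if_distrib[of "\<lambda>z. _ * z"] if_distrib[of cnj]
          simp del: sum.lessThan_Suc simp flip: of_real_mult cong: if_cong)
qed

lemma diag_maps_platypus_compl:
  "diag_maps (Suc d) d (Suc d) (\<lambda>e b. platypus_kraus d \<mu> b e) f (\<lambda>e. \<mu> e * f 0 + f (Suc e))"
  unfolding diag_maps_def
proof (intro allI impI)
  fix x x' assume x: "x < d" "x' < d"
  show "(\<Sum>b<Suc d. \<Sum>a<Suc d. complex_of_real (f a) * (platypus_kraus d \<mu> b x a * cnj (platypus_kraus d \<mu> b x' a)))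
    = (if x = x' then complex_of_real (\<mu> x * f 0 + f (Suc x)) else 0)"
    using x \<mu>_nonneg
    by (subst sum.lessThan_Suc, unfold sum.lessThan_Suc_shift)
       (auto simp: platypus_kraus_simps if_distrib[of "\<lambda>z. z * _"] if_distrib[of "\<lambda>z. _ * z"] if_distrib[of cnj]
          simp flip: of_real_mult cong: if_cong)
qed


lemma shannon_half: "(\<Sum>i<d. entropy_fun (\<mu> i / 2)) = (1 + shannon d \<mu>) / 2"
proof -
  have "(\<Sum>i<d. entropy_fun (\<mu> i / 2)) = (\<Sum>i<d. \<mu> i / 2 + entropy_fun (\<mu> i) / 2)"
    using \<mu>_nonneg entropy_fun_mult[of _ "1 / 2"] by (intro sum.cong refl) (simp add: entropy_fun_half)
  then show ?thesis by (simp add: sum.distrib \<mu>_sum shannon_def add_divide_distrib flip: sum_divide_distrib)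
qed

text \<open>The letters \<open>|0\<rangle>\<langle>0|\<close> and \<open>\<Sum>\<^sub>j \<mu>\<^sub>j |j+1\<rangle>\<langle>j+1|\<close> have orthogonal outputs, while the environment
  receives \<open>diag \<mu>\<close> in both cases.\<close>

definition code_input :: "nat \<Rightarrow> nat \<Rightarrow> real" where
  "code_input s a = (if s = 0 then (if a = 0 then 1 else 0) else (if a = 0 then 0 else \<mu> (a - 1)))"

definition code_output :: "nat \<Rightarrow> nat \<Rightarrow> real" where
  "code_output s b = (if b < d then \<mu> b * code_input s 0 else \<Sum>i<d. code_input s (Suc i))"

lemma distribution_code_input: "distribution (Suc d) (code_input s)"
  by (cases "s = 0")
     (auto simp: distribution_def code_input_def \<mu>_nonneg \<mu>_sum sum.lessThan_Suc_shift simp del: sum.lessThan_Suc)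

lemma distribution_code_output: "distribution (Suc d) (code_output s)"
  by (cases "s = 0") (auto simp: distribution_def code_output_def code_input_def \<mu>_nonneg \<mu>_sum)

lemma distribution_code_average: "distribution (Suc d) (\<lambda>b. (code_output 0 b + code_output 1 b) / 2)"
  using distribution_code_output[of 0] distribution_code_output[of 1]
  by (simp add: distribution_def sum.distrib flip: sum_divide_distrib del: sum.lessThan_Suc)

lemma shannon_code_output: "shannon (Suc d) (code_output 0) = shannon d \<mu>" "shannon (Suc d) (code_output 1) = 0"
  by (simp_all add: shannon_def code_output_def code_input_def \<mu>_sum entropy_fun_def)

text \<open>Grouping rule for entropy: the two letter outputs have disjoint supports, so the fair
  choice between them adds exactly one bit to their mean entropy
  \<open>shannon d \<mu> / 2\<close>.\<close>

lemma shannon_code_average: "shannon (Suc d) (\<lambda>b. (code_output 0 b + code_output 1 b) / 2) = 1 + shannon d \<mu> / 2"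
  using shannon_half by (simp add: shannon_def code_output_def code_input_def \<mu>_sum entropy_fun_half field_simps)

section \<open>Code ensembles and the rates they attain\<close>

lemma code_ensemble:
  assumes "\<And>s. distribution n (f s)"
  shows "ensemble (n ^ m) (2 ^ m) (\<lambda>_. 1 / 2 ^ m) (\<lambda>s. diag_real (n ^ m) (word_fun n f m s))"
  using assms by (simp add: ensemble_def density_diag_real distribution_word_fun)

lemma ens_avg_word_fun:
  "ens_avg (n ^ m) (2 ^ m) (\<lambda>_. 1 / 2 ^ m) (\<lambda>s. diag_real (n ^ m) (word_fun n f m s))
    = diag_real (n ^ m) (pow_fun n (\<lambda>i. (f 0 i + f 1 i) / 2) m)"
proof (rule eq_matI)
  fix i j assume "i < dim_row (diag_real (n ^ m) (pow_fun n (\<lambda>i. (f 0 i + f 1 i) / 2) m))"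
    "j < dim_col (diag_real (n ^ m) (pow_fun n (\<lambda>i. (f 0 i + f 1 i) / 2) m))"
  then have ij: "i < n ^ m" "j < n ^ m" by (auto simp: diag_real_def)
  have "(\<Sum>s<2^m. complex_of_real (1 / 2 ^ m) * complex_of_real (word_fun n f m s i))
    = complex_of_real (1 / 2 ^ m * (\<Sum>s<2^m. word_fun n f m s i))"
    by (simp add: sum_distrib_left)
  also have "\<dots> = complex_of_real (pow_fun n (\<lambda>i. (f 0 i + f 1 i) / 2) m i)"
    by (simp add: sum_word_fun)
  finally show "ens_avg (n ^ m) (2 ^ m) (\<lambda>_. 1 / 2 ^ m) (\<lambda>s. diag_real (n ^ m) (word_fun n f m s)) $$ (i, j)
    = diag_real (n ^ m) (pow_fun n (\<lambda>i. (f 0 i + f 1 i) / 2) m) $$ (i, j)"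
    using ij by (cases "i = j") (simp_all add: ens_avg_index diag_real_def)
qed (auto simp: ens_avg_def diag_real_def)

lemma holevo_word_fun:
  assumes f: "\<And>s. distribution n (f s)" and a: "distribution n (\<lambda>i. (f 0 i + f 1 i) / 2)"
  shows "vN_entropy (ens_avg (n ^ m) (2 ^ m) (\<lambda>_. 1 / 2 ^ m) (\<lambda>s. diag_real (n ^ m) (word_fun n f m s)))
      - (\<Sum>s<2^m. 1 / 2 ^ m * vN_entropy (diag_real (n ^ m) (word_fun n f m s)))
    = real m * (shannon n (\<lambda>i. (f 0 i + f 1 i) / 2) - (shannon n (f 0) + shannon n (f 1)) / 2)"
  unfolding ens_avg_word_fun vN_entropy_diag_real shannon_pow_fun[OF a] sum_distrib_left[symmetric]
    sum_shannon_word_fun[OF f]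
  by (simp add: right_diff_distrib)

lemma code_holevo_private:
  defines "R \<equiv> \<lambda>m s. diag_real (Suc d ^ m) (word_fun (Suc d) code_input m s)"
  shows "ensemble (Suc d ^ m) (2 ^ m) (\<lambda>_. 1 / 2 ^ m) (R m)"
    and "holevo_ens (tensor_pow (platypus d \<mu>) m) (2 ^ m) (\<lambda>_. 1 / 2 ^ m) (R m) = real m"
    and "private_info_ens (tensor_pow (platypus d \<mu>) m) (2 ^ m) (\<lambda>_. 1 / 2 ^ m) (R m) = real m"
proof -
  show e: "ensemble (Suc d ^ m) (2 ^ m) (\<lambda>_. 1 / 2 ^ m) (R m)"
    unfolding R_def by (rule code_ensemble[OF distribution_code_input])
  have "diag_maps (Suc d) (Suc d) d (platypus_kraus d \<mu>) (code_input s) (code_output s)" for s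
    unfolding code_output_def[abs_def] by (rule diag_maps_platypus)
  then have B: "cp_map (Suc d ^ m) (Suc d ^ m) (d ^ m) (kraus_pow (Suc d) (Suc d) d (platypus_kraus d \<mu>) m) (R m s)
    = diag_real (Suc d ^ m) (word_fun (Suc d) code_output m s)" for s
    unfolding R_def by (intro cp_map_diag_real diag_maps_word_fun)
  have "diag_maps (Suc d) d (Suc d) (\<lambda>e b. platypus_kraus d \<mu> b e) (code_input s) \<mu>" for s
  proof -
    \<comment> \<open>Either the term at 0 or the shifted term is \<mu>, and the other one
      vanishes.\<close>
    have "(\<lambda>e. \<mu> e * code_input s 0 + code_input s (Suc e)) = \<mu>" by (auto simp: code_input_def)
    then show ?thesis using diag_maps_platypus_compl[of "code_input s"] by simp
  qed
  then have E: "cp_map (Suc d ^ m) (d ^ m) (Suc d ^ m) (\<lambda>e b. kraus_pow (Suc d) (Suc d) d (platypus_kraus d \<mu>) m b e) (R m s)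
    = diag_real (d ^ m) (word_fun d (\<lambda>_. \<mu>) m s)" for s
    unfolding R_def kraus_pow_swap by (intro cp_map_diag_real diag_maps_word_fun)
  show h: "holevo_ens (tensor_pow (platypus d \<mu>) m) (2 ^ m) (\<lambda>_. 1 / 2 ^ m) (R m) = real m"
    unfolding holevo_ens_eq[OF dilation_platypus_pow e] B
      holevo_word_fun[OF distribution_code_output distribution_code_average]
    unfolding shannon_code_average shannon_code_output by simp
  \<comment> \<open>Seen from the environment both letters are \<mu>, so
    \<open>holevo_word_fun\<close> gives its Holevo quantity as \<open>m\<close> times a difference
    that is zero.\<close>
  have "distribution d (\<lambda>i. (\<mu> i + \<mu> i) / 2)" using \<mu> by simp
  note z = holevo_word_fun[of d "\<lambda>_. \<mu>", OF \<mu> this]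
  show "private_info_ens (tensor_pow (platypus d \<mu>) m) (2 ^ m) (\<lambda>_. 1 / 2 ^ m) (R m) = real m"
    unfolding private_info_ens_eq[OF dilation_platypus_pow e] E h z by simp
qed

section \<open>Values of the capacities\<close>

lemma capacity_platypus_pow:
  "holevo_capacity (tensor_pow (platypus d \<mu>) m) = real m"
  "private_information (tensor_pow (platypus d \<mu>) m) = real m"
proof -
  have i: "in_dim (tensor_pow (platypus d \<mu>) m) = Suc d ^ m"
    by (rule dilation_in_dim[OF dilation_platypus_pow])
  show "holevo_capacity (tensor_pow (platypus d \<mu>) m) = real m"
    unfolding holevo_capacity_def i
  \<comment> \<open>A real \<open>Sup\<close> is informative only for bounded nonempty sets;
    exhibiting the value as a maximum settles both at once.\<close>
  proof (rule cSup_eq_maximum)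
    show "real m \<in> {holevo_ens (tensor_pow (platypus d \<mu>) m) k p \<rho> |k p \<rho>. ensemble (Suc d ^ m) k p \<rho>}"
      using code_holevo_private(1) code_holevo_private(2)[of m, symmetric] by blast
  qed (use holevo_ens_platypus_pow_le in blast)
  show "private_information (tensor_pow (platypus d \<mu>) m) = real m"
    unfolding private_information_def i
  proof (rule cSup_eq_maximum)
    show "real m \<in> {private_info_ens (tensor_pow (platypus d \<mu>) m) k p \<rho> |k p \<rho>. ensemble (Suc d ^ m) k p \<rho>}"
      using code_holevo_private(1) code_holevo_private(3)[of m, symmetric] by blast
  next
    fix x assume "x \<in> {private_info_ens (tensor_pow (platypus d \<mu>) m) k p \<rho> |k p \<rho>. ensemble (Suc d ^ m) k p \<rho>}"
    then obtain k p \<rho> where x: "x = private_info_ens (tensor_pow (platypus d \<mu>) m) k p \<rho>"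
      and e: "ensemble (Suc d ^ m) k p \<rho>" by blast
    show "x \<le> real m"
      unfolding x using private_info_ens_le_holevo_ens[OF dilation_platypus_pow e] holevo_ens_platypus_pow_le[OF e]
      by linarith
  qed
qed

text \<open>\<open>tensor_pow\<close> starts from the trivial dilation, so its first power is a
  product with a one-dimensional factor whose digits are all 0. The identity lets the single-use
  values be read off from \<open>m = 1\<close>.\<close>

lemma tensor_pow_platypus_1: "tensor_pow (platypus d \<mu>) 1 = platypus d \<mu>"
proof -
  have d: "0 < d" using \<mu>_sum by (cases d) auto
  have "mat (Suc d * d) (Suc d) (\<lambda>(r, c). 1\<^sub>m 1 $$ (r div d div Suc d * 1 + r mod d div d, c div Suc d)
      * platypus_iso d \<mu> $$ (r div d mod Suc d * d + r mod d mod d, c mod Suc d)) = platypus_iso d \<mu>"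
  proof (rule eq_matI)
    fix r c assume "r < dim_row (platypus_iso d \<mu>)" "c < dim_col (platypus_iso d \<mu>)"
    then have r: "r < Suc d * d" and c: "c < Suc d" by (auto simp: platypus_iso_def)
    have "r div d < Suc d" using r by (rule less_mult_imp_div_less)
    then show "mat (Suc d * d) (Suc d) (\<lambda>(r, c). 1\<^sub>m 1 $$ (r div d div Suc d * 1 + r mod d div d, c div Suc d)
        * platypus_iso d \<mu> $$ (r div d mod Suc d * d + r mod d mod d, c mod Suc d)) $$ (r, c) = platypus_iso d \<mu> $$ (r, c)"
      using r c d by (simp del: mult_Suc)
  qed (auto simp: platypus_iso_def)
  moreover have "dim_col (platypus_iso d \<mu>) = Suc d" by (simp add: platypus_iso_def)
  moreover have "tensor_pow (platypus d \<mu>) 1 = iso_tensor (1, 1, 1\<^sub>m 1) (platypus d \<mu>)" by simp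
  ultimately show ?thesis
    by (simp add: platypus_def iso_tensor_def Let_def Suc_eq_plus1[symmetric] Suc_eq_plus1_left[symmetric] del: mult_Suc One_nat_def)
qed

text \<open>The constant 4 is 2 + 2: against the weights \<mu>/2 and 1/2, the levels below
  \<open>d\<close> together contribute at most twice the squared norm of the unit vector
  \<open>v\<close>, and level \<open>d\<close> contributes exactly that amount.\<close>

lemma ea_capacity_platypus: "ea_capacity (platypus d \<mu>) = 2"
proof -
  let ?N = "platypus d \<mu>" and ?K = "platypus_kraus d \<mu>"
  let ?B = "cp_map (Suc d) (Suc d) d ?K" and ?E = "cp_map (Suc d) d (Suc d) (\<lambda>e b. ?K b e)"
  have ci: "coherent_info \<rho> ?N = vN_entropy (?B \<rho>) - vN_entropy (?E \<rho>)" if "density (Suc d) \<rho>" for \<rho>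
    unfolding coherent_info_def dilation_channel[OF dilation_platypus density_carrier[OF that]] by (rule refl)
  have upper: "vN_entropy \<rho> + coherent_info \<rho> ?N \<le> 2" if \<rho>: "density (Suc d) \<rho>" for \<rho>
  proof -
    let ?t = "\<lambda>b. platypus_weight d \<mu> b / 2"
    have "vN_entropy \<rho> + (vN_entropy (?B \<rho>) - vN_entropy (?E \<rho>)) \<le> log 2 4"
    proof (rule mutual_information_le_log[OF isometric_platypus \<rho>, where t="?t"])
      show "0 \<le> ?t b" if "b < Suc d" for b using \<mu>_nonneg by (simp add: platypus_weight_def)
      show "(\<Sum>b<Suc d. ?t b) \<le> 1" using \<mu>_sum by (simp add: platypus_weight_def flip: sum_divide_distrib)
      show "Re (?B \<rho> $$ (b, b)) = 0" if b: "b < Suc d" "?t b = 0" for b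
      proof -
        have "b < d" "\<mu> b = 0" using b by (auto simp: platypus_weight_def split: if_splits)
        then have "?K b e a = 0" for e a by (auto simp: platypus_kraus_def)
        then show ?thesis using b by (simp add: cp_map_def)
      qed
      fix v :: "nat \<Rightarrow> complex" assume v: "(\<Sum>e<d. (cmod (v e))\<^sup>2) = 1"
      have "(\<Sum>a<Suc d. (cmod (\<Sum>e<d. cnj (v e) * ?K b e a))\<^sup>2) / ?t b \<le> 2 * (cmod (v b))\<^sup>2" if b: "b < d" for b
      proof -
        \<comment> \<open>Only input 0 reaches level \<open>b < d\<close>. Dividing by
          \<open>\<mu> b / 2\<close> then leaves \<open>2 * (cmod (v b))\<^sup>2\<close>, or 0 when
          \<open>\<mu> b = 0\<close>.\<close>
        have "(\<Sum>a<Suc d. (cmod (\<Sum>e<d. cnj (v e) * ?K b e a))\<^sup>2) = (cmod (v b))\<^sup>2 * \<mu> b"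
          using b \<mu>_nonneg[OF b]
          by (simp add: sum.lessThan_Suc_shift platypus_kraus_simps if_distrib[of "\<lambda>z. _ * z"] norm_mult power_mult_distrib
              del: sum.lessThan_Suc cong: if_cong)
        then show ?thesis using b by (cases "\<mu> b = 0") (auto simp: platypus_weight_def)
      qed
      moreover have "(\<Sum>a<Suc d. (cmod (\<Sum>e<d. cnj (v e) * ?K d e a))\<^sup>2) / ?t d = 2"
        using v by (simp add: sum.lessThan_Suc_shift platypus_kraus_simps platypus_weight_def if_distrib[of "\<lambda>z. _ * z"]
              del: sum.lessThan_Suc cong: if_cong)
      ultimately have "(\<Sum>b<Suc d. (\<Sum>a<Suc d. (cmod (\<Sum>e<d. cnj (v e) * ?K b e a))\<^sup>2) / ?t b)
          \<le> (\<Sum>b<d. 2 * (cmod (v b))\<^sup>2) + 2"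
        unfolding sum.lessThan_Suc[of "\<lambda>b. (\<Sum>a<Suc d. (cmod (\<Sum>e<d. cnj (v e) * ?K b e a))\<^sup>2) / ?t b"]
        by (intro add_mono sum_mono) auto
      also have "\<dots> = 4" using v by (simp flip: sum_distrib_left)
      finally show "(\<Sum>b<Suc d. (\<Sum>a<Suc d. (cmod (\<Sum>e<d. cnj (v e) * ?K b e a))\<^sup>2) / ?t b) \<le> 4" .
    qed simp
    also have "log 2 (4::real) = 2" using log_nat_power[of 2 2 2] by simp
    finally show ?thesis by (simp add: ci[OF \<rho>])
  qed
  define f where "f a = (code_input 0 a + code_input 1 a) / 2" for a
  have f: "distribution (Suc d) f"
    using distribution_code_input[of 0] distribution_code_input[of 1]
    by (simp add: f_def distribution_def sum.distrib flip: sum_divide_distrib del: sum.lessThan_Suc)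
  have fb: "(\<lambda>b. if b < d then \<mu> b * f 0 else \<Sum>i<d. f (Suc i)) = (\<lambda>b. (code_output 0 b + code_output 1 b) / 2)"
    by (rule ext) (simp add: f_def code_output_def code_input_def flip: sum_divide_distrib)
  have fe: "(\<lambda>e. \<mu> e * f 0 + f (Suc e)) = \<mu>"
    by (auto simp: f_def code_input_def)
  \<comment> \<open>Input and output both have entropy \<open>1 + shannon d \<mu> / 2\<close> and
    the environment has \<open>shannon d \<mu>\<close>, so the dependence on \<mu> cancels.\<close>
  have "vN_entropy (diag_real (Suc d) f) + coherent_info (diag_real (Suc d) f) ?N
    = shannon (Suc d) f + (1 + shannon d \<mu> / 2 - shannon d \<mu>)"
    unfolding ci[OF density_diag_real[OF f]] cp_map_diag_real[OF diag_maps_platypus[of f]]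
      cp_map_diag_real[OF diag_maps_platypus_compl[of f]] vN_entropy_diag_real fb fe shannon_code_average
    by (rule refl)
  also have "shannon (Suc d) f = 1 + shannon d \<mu> / 2"
    unfolding shannon_def sum.lessThan_Suc_shift using shannon_half
    by (simp add: f_def code_input_def entropy_fun_half shannon_def field_simps)
  finally have "2 = vN_entropy (diag_real (Suc d) f) + coherent_info (diag_real (Suc d) f) ?N" by simp
  then have "2 \<in> {vN_entropy \<rho> + coherent_info \<rho> ?N |\<rho>. density (Suc d) \<rho>}"
    using density_diag_real[OF f] by blast
  then show ?thesis
    unfolding ea_capacity_def dilation_in_dim[OF dilation_platypus]
    by (rule cSup_eq_maximum) (use upper in blast)
qed

end

theorem theorem2:
  fixes d :: nat and \<mu> :: "nat \<Rightarrow> real"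
  assumes "d \<ge> 1"
    and "\<forall>j<d. 0 \<le> \<mu> j" and "(\<Sum>j<d. \<mu> j) = 1"
  shows "private_information (platypus d \<mu>) = 1
    \<and> holevo_capacity (platypus d \<mu>) = 1
    \<and> (\<lambda>n. private_information (tensor_pow (platypus d \<mu>) n) / real n) \<longlonglongrightarrow> 1
    \<and> (\<lambda>n. holevo_capacity (tensor_pow (platypus d \<mu>) n) / real n) \<longlonglongrightarrow> 1
    \<and> ea_capacity (platypus d \<mu>) = 2"
proof -
  have \<mu>: "distribution d \<mu>" using assms by (simp add: distribution_def)
  note cap = capacity_platypus_pow[OF \<mu>]
  \<comment> \<open>At \<open>n = 0\<close> the quotient is 0 by convention, so the sequence is
    constant only from 1 on.\<close>
  have lim: "(\<lambda>n. real n / real n) \<longlonglongrightarrow> 1"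
    by (rule tendsto_eventually) (use eventually_gt_at_top[of "0::nat"] in \<open>auto elim: eventually_mono\<close>)
  show ?thesis
    using cap[of 1] lim unfolding tensor_pow_platypus_1[OF \<mu>] cap
    by (simp add: ea_capacity_platypus[OF \<mu>])
qed

end
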